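(* Let $P=(X,\prec)$ be a finite poset and let $z_1,z_2,z_3\in X$ be distinct. For all integers $k,\ell\ge1$, $$\mathrm{F}(k,\ell)\,\mathrm{F}(k+1,\ell+1)\ \le\ 2\,\mathrm{F}(k+1,\ell)\,\mathrm{F}(k,\ell+1),$$ where $\mathrm{F}(a,b)$ is the number of linear extensions $L$ of $P$ with $L(z_2)-L(z_1)=a$ and $L(z_3)-L(z_2)=b$.
   Context: A linear extension of a finite poset $P=(X,\prec)$ with $|X|=n$ is a bijection $L:X\to\{1,\dots,n\}$ with $L(u)<L(v)$ whenever $u\prec v$. *)

theory Defs
  imports "HOL-Library.FuncSet"
begin

text \<open>A strict order on the carrier \<open>X\<close>; values of \<open>prec\<close> outside \<open>X\<close> play no role.\<close>

definition finite_poset :: "'a set \<Rightarrow> ('a \<Rightarrow> 'a \<Rightarrow> bool) \<Rightarrow> bool" where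
  "finite_poset X prec \<longleftrightarrow> finite X \<and> irreflp_on X prec \<and> transp_on X prec"

text \<open>Taking extensional functions (undefined outside \<open>X\<close>) makes each map on \<open>X\<close> be
  represented by exactly one HOL function, so that cardinalities of sets of linear extensions
  count what they should.\<close>

definition linear_extensions :: "'a set \<Rightarrow> ('a \<Rightarrow> 'a \<Rightarrow> bool) \<Rightarrow> ('a \<Rightarrow> nat) set" where
  "linear_extensions X prec =
     {L \<in> X \<rightarrow>\<^sub>E {1..card X}.
        bij_betw L X {1..card X} \<and> (\<forall>u\<in>X. \<forall>v\<in>X. prec u v \<longrightarrow> L u < L v)}"

text \<open>The differences are taken in the integers, so that they are not truncated.\<close>

definition F :: "'a set \<Rightarrow> ('a \<Rightarrow> 'a \<Rightarrow> bool) \<Rightarrow> 'a \<Rightarrow> 'a \<Rightarrow> 'a \<Rightarrow> int \<Rightarrow> int \<Rightarrow> nat" where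
  "F X prec z1 z2 z3 a b =
     card {L \<in> linear_extensions X prec.
             int (L z2) - int (L z1) = a \<and> int (L z3) - int (L z2) = b}"

end

theory Submission
  imports Defs Complex_Main "HOL-Library.Multiset"
begin

text \<open>The inequality is the Favard inequality \<open>Q c c * Q a b \<le> 2 * Q c a * Q c b\<close>, valid for
  symmetric bilinear forms with at most one positive direction, applied to a form whose entries are
  the numbers \<open>F\<close>. In the literature these entries are mixed volumes of slices of the order
  polytope, and the signature comes from the Alexandrov--Fenchel inequality; here the signature is
  proved combinatorially, by a Bochner-type induction in the spirit of the combinatorial atlas of
  Chan and Pak.

  Remove \<open>z1, z2, z3\<close> from the poset. A linear extension becomes a word in the other elements,
  cut into four arcs by the positions of \<open>z1, z2, z3\<close>. Instead of forbidding a letter in an arc, give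
  it the weight \<open>\<epsilon>\<close> to the number of violated relations with the \<open>zi\<close>. All weighted counts are then
  positive, and the weights of consecutive arcs have a quotient which is antitone in the poset; this is
  all that the induction needs. Two steps build up the form: reading the first letter of a word, and
  gluing the last arc to the first one, which sums over the position of \<open>z1\<close>. At the end
  \<open>\<epsilon>\<close> tends to \<open>0\<close>.\<close>

section \<open>Symmetric bilinear forms with at most one positive direction\<close>

text \<open>Vertices of an electrical network are eliminated one at a time. The diagonal of
  \<open>c\<close> cancels; in the application its sign is unknown.\<close>

lemma laplacian_solvable:
  fixes c :: "'b \<Rightarrow> 'b \<Rightarrow> real" and r :: "'b \<Rightarrow> real"
  assumes "finite E"
    and "\<And>x y. x \<in> E \<Longrightarrow> y \<in> E \<Longrightarrow> x \<noteq> y \<Longrightarrow> c x y > 0"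
    and "\<And>x y. x \<in> E \<Longrightarrow> y \<in> E \<Longrightarrow> c x y = c y x"
    and "sum r E = 0"
  shows "\<exists>u. \<forall>x\<in>E. (\<Sum>y\<in>E. c x y * (u x - u y)) = r x"
  using assms
proof (induction E arbitrary: c r rule: finite_induct)
  case empty
  then show ?case by simp
next
  case (insert z E)
  show ?case
  proof (cases "E = {}")
    case True
    then show ?thesis using insert.prems by simp
  next
    case False
    define s where "s = (\<Sum>y\<in>E. c z y)"
    have cz: "c z y > 0" if "y \<in> E" for y
      using insert.prems(1)[of z y] insert.hyps that by auto
    have s: "s > 0"
      unfolding s_def using insert.hyps False cz by (intro sum_pos) auto
    \<comment> \<open>Star-mesh transformation: \<open>c'\<close> and \<open>r'\<close> are the
      conductances and currents left on \<open>E\<close> once the potential at \<open>z\<close> is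
      eliminated.\<close>
    define c' where "c' x y = c x y + c x z * c z y / s" for x y
    define r' where "r' x = r x + c x z * r z / s" for x
    have sE: "(\<Sum>x\<in>E. c x z) = s"
      unfolding s_def by (rule sum.cong) (use insert.prems(2) in auto)
    have "sum r' E = sum r E + s * r z / s"
      unfolding r'_def by (simp add: sum.distrib flip: sum_divide_distrib sum_distrib_right sE)
    also have "\<dots> = 0"
      using insert.prems(3) insert.hyps s by simp
    finally have r': "sum r' E = 0" .
    have pos: "c' x y > 0" if "x \<in> E" "y \<in> E" "x \<noteq> y" for x y
      unfolding c'_def using that insert.prems(1,2) cz s by (metis add_pos_pos divide_pos_pos insertCI mult_pos_pos)
    have sym: "c' x y = c' y x" if "x \<in> E" "y \<in> E" for x y
      unfolding c'_def using that insert.prems(2)[of x y] insert.prems(2)[of x z] insert.prems(2)[of z y] by simp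
    obtain u where u: "\<forall>x\<in>E. (\<Sum>y\<in>E. c' x y * (u x - u y)) = r' x"
      using insert.IH[of c' r', OF pos sym r'] by blast
    define uz where "uz = (r z + (\<Sum>y\<in>E. c z y * u y)) / s"
    define v where "v = u(z := uz)"
    have vE: "v x = u x" if "x \<in> E" for x
      using that insert.hyps by (auto simp: v_def)
    have suz: "s * uz = r z + (\<Sum>y\<in>E. c z y * u y)"
      unfolding uz_def using s by simp
    have "(\<Sum>y\<in>insert z E. c x y * (v x - v y)) = r x" if x: "x \<in> insert z E" for x
    proof (cases "x = z")
      case True
      have "(\<Sum>y\<in>insert z E. c z y * (v z - v y)) = (\<Sum>y\<in>E. c z y * (uz - u y))"
        using insert.hyps by (simp add: v_def) (rule sum.cong, auto)
      also have "\<dots> = s * uz - (\<Sum>y\<in>E. c z y * u y)"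
        by (simp add: right_diff_distrib sum_subtractf s_def sum_distrib_right)
      finally show ?thesis using suz True by simp
    next
      case False
      then have x: "x \<in> E" using x by simp
      have e1: "(\<Sum>y\<in>E. c' x y * (u x - u y))
          = (\<Sum>y\<in>E. c x y * (u x - u y)) + (\<Sum>y\<in>E. c x z / s * (c z y * (u x - u y)))"
        unfolding c'_def sum.distrib[symmetric]
        by (intro sum.cong refl) (simp add: algebra_simps diff_divide_distrib)
      have e2: "(\<Sum>y\<in>E. c x z / s * (c z y * (u x - u y)))
          = c x z / s * (s * u x - (\<Sum>y\<in>E. c z y * u y))"
      proof -
        have "(\<Sum>y\<in>E. c z y * (u x - u y)) = s * u x - (\<Sum>y\<in>E. c z y * u y)"
          by (simp add: right_diff_distrib sum_subtractf s_def sum_distrib_right)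
        then show ?thesis by (metis sum_distrib_left)
      qed
      have e3: "c x z / s * (s * u x - (\<Sum>y\<in>E. c z y * u y)) = c x z * (u x - uz) + c x z * r z / s"
      proof -
        have *: "(\<Sum>y\<in>E. c z y * u y) = s * uz - r z" using suz by simp
        show ?thesis unfolding * using s by (simp add: field_simps)
      qed
      have "r x = (\<Sum>y\<in>E. c x y * (u x - u y)) + c x z * (u x - uz)"
        using bspec[OF u x] e1 e2 e3 by (simp add: r'_def)
      also have "\<dots> = (\<Sum>y\<in>E. c x y * (v x - v y)) + c x z * (v x - v z)"
        using x vE by (simp add: v_def)
      finally show ?thesis using insert.hyps by simp
    qed
    then show ?thesis by blast
  qed
qed

section \<open>Forms with a reversed Cauchy-Schwarz inequality\<close>

definition symmetric_bilinear :: "(('i \<Rightarrow> real) \<Rightarrow> ('i \<Rightarrow> real) \<Rightarrow> real) \<Rightarrow> bool" where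
  "symmetric_bilinear Q \<longleftrightarrow>
     (\<forall>u v. Q u v = Q v u) \<and>
     (\<forall>u v w c. Q (\<lambda>i. u i + c * v i) w = Q u w + c * Q v w)"

text \<open>For symmetric bilinear forms: no two-dimensional subspace is positive definite. No
  eigenvalues occur, so infinite dimension is harmless.\<close>

definition hyperbolic :: "(('i \<Rightarrow> real) \<Rightarrow> ('i \<Rightarrow> real) \<Rightarrow> real) \<Rightarrow> bool" where
  "hyperbolic Q \<longleftrightarrow> (\<forall>u v. 0 < Q v v \<longrightarrow> Q u u * Q v v \<le> (Q u v)\<^sup>2)"

lemma symmetric_bilinear_commute: "symmetric_bilinear Q \<Longrightarrow> Q u v = Q v u"
  unfolding symmetric_bilinear_def by blast

lemma symmetric_bilinear_add_scaled:
  assumes "symmetric_bilinear Q"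
  shows "Q (\<lambda>i. u i + c * v i) w = Q u w + c * Q v w"
    and "Q w (\<lambda>i. u i + c * v i) = Q w u + c * Q w v"
  using assms unfolding symmetric_bilinear_def by metis+

lemma symmetric_bilinear_add_sum:
  assumes Q: "symmetric_bilinear Q" and "finite E"
  shows "Q (\<lambda>i. v i + (\<Sum>e\<in>E. u e * g e i)) w = Q v w + (\<Sum>e\<in>E. u e * Q (g e) w)"
  using \<open>finite E\<close>
proof (induction E rule: finite_induct)
  case empty
  then show ?case by simp
next
  case (insert z E)
  have "(\<lambda>i. v i + (\<Sum>e\<in>insert z E. u e * g e i))
      = (\<lambda>i. (v i + (\<Sum>e\<in>E. u e * g e i)) + u z * g z i)"
    using insert.hyps by (auto simp: algebra_simps)
  then show ?case
    using insert symmetric_bilinear_add_scaled(1)[OF Q] by simp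
qed

lemma hyperbolicD:
  assumes "symmetric_bilinear Q" "hyperbolic Q" "0 < Q w w"
  shows "Q v v \<le> (Q w v)\<^sup>2 / Q w w"
  using assms symmetric_bilinear_commute[OF assms(1), of w v]
  unfolding hyperbolic_def by (metis pos_le_divide_eq)

text \<open>One positive vector \<open>w\<close> suffices: some \<open>x = u - t * v\<close> is
  orthogonal to \<open>w\<close>, and completing the square in \<open>Q x x \<le> 0\<close> gives
  the inequality for \<open>u\<close> and \<open>v\<close>.\<close>

lemma hyperbolicI:
  assumes Q: "symmetric_bilinear Q" and w: "0 < Q w w"
    and neg: "\<And>v. Q w v = 0 \<Longrightarrow> Q v v \<le> 0"
  shows "hyperbolic Q"
  unfolding hyperbolic_def
proof (intro allI impI)
  fix u v :: "'a \<Rightarrow> real"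
  assume v: "0 < Q v v"
  have wv: "Q w v \<noteq> 0" using neg v by fastforce
  define t where "t = Q w u / Q w v"
  define x where "x = (\<lambda>i. u i + (- t) * v i)"
  have "Q w x = 0"
    unfolding x_def symmetric_bilinear_add_scaled(2)[OF Q] using wv by (simp add: t_def)
  then have "Q x x \<le> 0" by (rule neg)
  moreover have "Q x x = Q u u - 2 * t * Q u v + t\<^sup>2 * Q v v"
    unfolding x_def symmetric_bilinear_add_scaled[OF Q]
    by (simp add: symmetric_bilinear_commute[OF Q, of v u] algebra_simps power2_eq_square)
  ultimately have "Q u u * Q v v \<le> (2 * t * Q u v - t\<^sup>2 * Q v v) * Q v v"
    using v by (intro mult_right_mono) auto
  also have "\<dots> = (Q u v)\<^sup>2 - (Q u v - t * Q v v)\<^sup>2"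
    by (simp add: algebra_simps power2_eq_square)
  finally show "Q u u * Q v v \<le> (Q u v)\<^sup>2"
    by (smt (verit) zero_le_power2)
qed

text \<open>Four times the defect is the square of \<open>g u * h v - g v * h u\<close>. This serves
  the base cases of both inductions.\<close>

lemma hyperbolic_product:
  assumes "symmetric_bilinear Q"
    and "\<And>v. Q v v = g v * h v"
    and "\<And>u v. 2 * Q u v = g u * h v + g v * h u"
  shows "hyperbolic Q"
  unfolding hyperbolic_def
proof (intro allI impI)
  fix u v :: "'a \<Rightarrow> real"
  have "4 * (Q u v)\<^sup>2 = (g u * h v + g v * h u)\<^sup>2"
    using assms(3)[of u v] by (metis (no_types, lifting) four_x_squared)
  moreover have "(g u * h v + g v * h u)\<^sup>2 = 4 * (Q u u * Q v v) + (g u * h v - g v * h u)\<^sup>2"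
    unfolding assms(2) by (simp add: algebra_simps power2_eq_square)
  ultimately show "Q u u * Q v v \<le> (Q u v)\<^sup>2"
    by (smt (verit) zero_le_power2)
qed

text \<open>For \<open>Q w v = 0\<close> one solves the Laplace equation with conductances \<open>Q (g e) (g e')\<close> and
  right-hand side \<open>Q (g e) v\<close>. Evaluating the last assumption at \<open>v\<close> corrected by the solution
  \<open>u\<close> leaves minus the Dirichlet energy of \<open>u\<close> as an upper bound for \<open>Q v v\<close>.\<close>

lemma hyperbolic_local_to_global:
  fixes g :: "'b \<Rightarrow> 'i \<Rightarrow> real"
  assumes Q: "symmetric_bilinear Q" and E: "finite E" "E \<noteq> {}"
    and w: "\<And>v. Q w v = (\<Sum>e\<in>E. Q (g e) v)"
    and off: "\<And>e e'. e \<in> E \<Longrightarrow> e' \<in> E \<Longrightarrow> e \<noteq> e' \<Longrightarrow> 0 < Q (g e) (g e')"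
    and pos: "\<And>e. e \<in> E \<Longrightarrow> 0 < Q (g e) w"
    and bound: "\<And>v. Q v v \<le> (\<Sum>e\<in>E. (Q (g e) v)\<^sup>2 / Q (g e) w)"
  shows "hyperbolic Q"
proof (rule hyperbolicI[OF Q])
  note comm = symmetric_bilinear_commute[OF Q]
  have "Q w w = (\<Sum>e\<in>E. Q (g e) w)" by (rule w)
  also have "\<dots> > 0" using E pos by (intro sum_pos) auto
  finally show "0 < Q w w" .
  fix v assume wv: "Q w v = 0"
  define r where "r e = Q (g e) v" for e
  define M where "M e e' = Q (g e) (g e')" for e e'
  have "sum r E = 0" using w[of v] wv by (simp add: r_def)
  then have "\<exists>u. \<forall>e\<in>E. (\<Sum>e'\<in>E. M e e' * (u e - u e')) = r e"
    using off by (intro laplacian_solvable[OF E(1)]) (auto simp: M_def intro: comm)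
  then obtain u where u: "\<forall>e\<in>E. (\<Sum>e'\<in>E. M e e' * (u e - u e')) = r e" by blast
  define x where "x = (\<lambda>i. v i + (\<Sum>e\<in>E. u e * g e i))"
  have d: "Q (g e) w = (\<Sum>e'\<in>E. M e e')" for e
    using w[of "g e"] comm by (simp add: M_def)
  have ru: "Q (g e) w * u e - (\<Sum>e'\<in>E. M e e' * u e') = r e" if "e \<in> E" for e
    using bspec[OF u that] by (simp add: d right_diff_distrib sum_subtractf sum_distrib_right)
  have gx: "Q (g e) x = r e + (\<Sum>e'\<in>E. M e e' * u e')" for e
  proof -
    have "Q x (g e) = Q v (g e) + (\<Sum>e'\<in>E. u e' * Q (g e') (g e))"
      unfolding x_def by (rule symmetric_bilinear_add_sum[OF Q E(1)])
    also have "(\<Sum>e'\<in>E. u e' * Q (g e') (g e)) = (\<Sum>e'\<in>E. M e e' * u e')"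
      unfolding M_def by (intro sum.cong refl) (metis comm mult.commute)
    finally show ?thesis using comm[of x "g e"] comm[of v "g e"] by (simp add: r_def)
  qed
  have gx': "Q (g e) x = Q (g e) w * u e" if "e \<in> E" for e
    using ru[OF that] gx[of e] by simp
  have "Q x x = Q v x + (\<Sum>e\<in>E. u e * Q (g e) x)"
    by (subst x_def) (rule symmetric_bilinear_add_sum[OF Q E(1)])
  also have "Q v x = Q v v + (\<Sum>e\<in>E. u e * r e)"
    unfolding comm[of v x] unfolding x_def symmetric_bilinear_add_sum[OF Q E(1)] r_def by simp
  finally have xx: "Q x x = Q v v + (\<Sum>e\<in>E. u e * r e) + (\<Sum>e\<in>E. u e * Q (g e) x)" .
  \<comment> \<open>By \<open>gx'\<close> the upper bound for \<open>Q x x\<close> equals the last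
    sum in \<open>xx\<close>, so the two cancel.\<close>
  have "(\<Sum>e\<in>E. (Q (g e) x)\<^sup>2 / Q (g e) w) = (\<Sum>e\<in>E. u e * Q (g e) x)"
    using gx' pos by (intro sum.cong) (auto simp: power2_eq_square)
  then have "Q v v \<le> - (\<Sum>e\<in>E. u e * r e)"
    using bound[of x] xx by simp
  also have "(\<Sum>e\<in>E. u e * r e) = (\<Sum>e\<in>E. \<Sum>e'\<in>E. M e e' * (u e - u e') * u e)"
  proof (intro sum.cong refl)
    fix e assume "e \<in> E"
    then have "u e * r e = u e * (\<Sum>e'\<in>E. M e e' * (u e - u e'))" using u by simp
    also have "\<dots> = (\<Sum>e'\<in>E. M e e' * (u e - u e') * u e)"
      unfolding sum_distrib_left by (simp add: mult_ac)
    finally show "u e * r e = (\<Sum>e'\<in>E. M e e' * (u e - u e') * u e)" .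
  qed
  \<comment> \<open>Adding the sum with \<open>e\<close> and \<open>e'\<close> exchanged produces
    the Dirichlet energy.\<close>
  also have "2 * \<dots> = (\<Sum>e\<in>E. \<Sum>e'\<in>E. M e e' * (u e - u e')\<^sup>2)"
  proof -
    have "(\<Sum>e\<in>E. \<Sum>e'\<in>E. M e e' * (u e - u e') * u e)
        = (\<Sum>e\<in>E. \<Sum>e'\<in>E. M e e' * (u e' - u e) * u e')"
      by (subst sum.swap, intro sum.cong refl) (simp add: M_def comm)
    then have "2 * (\<Sum>e\<in>E. \<Sum>e'\<in>E. M e e' * (u e - u e') * u e)
       = (\<Sum>e\<in>E. \<Sum>e'\<in>E. M e e' * (u e - u e') * u e) + (\<Sum>e\<in>E. \<Sum>e'\<in>E. M e e' * (u e' - u e) * u e')"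
      by simp
    also have "\<dots> = (\<Sum>e\<in>E. \<Sum>e'\<in>E. M e e' * (u e - u e')\<^sup>2)"
      unfolding sum.distrib[symmetric] by (intro sum.cong refl) (simp add: algebra_simps power2_eq_square)
    finally show ?thesis .
  qed
  moreover have "0 \<le> (\<Sum>e\<in>E. \<Sum>e'\<in>E. M e e' * (u e - u e')\<^sup>2)"
  proof (intro sum_nonneg)
    fix e e' assume "e \<in> E" "e' \<in> E"
    then show "0 \<le> M e e' * (u e - u e')\<^sup>2"
      using off[of e e'] by (cases "e = e'") (auto simp: M_def)
  qed
  ultimately show "Q v v \<le> 0" by linarith
qed

section \<open>Weighted words\<close>

definition minimal_elements :: "('a \<Rightarrow> 'a \<Rightarrow> bool) \<Rightarrow> 'a set \<Rightarrow> 'a set" where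
  "minimal_elements lt R = {x \<in> R. \<forall>y\<in>R. \<not> lt y x}"

text \<open>The list prescribes the arc of each position, and \<open>f j x\<close> is the weight of the letter \<open>x\<close>
  in arc \<open>j\<close>. The value is meaningful only if the length of the list is the cardinality of \<open>R\<close>.\<close>

fun weighted_count :: "('a \<Rightarrow> 'a \<Rightarrow> bool) \<Rightarrow> (nat \<Rightarrow> 'a \<Rightarrow> real) \<Rightarrow> 'a set \<Rightarrow> nat list \<Rightarrow> real" where
  "weighted_count lt f R [] = 1"
| "weighted_count lt f R (j # js) =
     (\<Sum>x\<in>minimal_elements lt R. f j x * weighted_count lt f (R - {x}) js)"

lemma sum_Diff_singleton_if:
  fixes h :: "'a \<Rightarrow> real"
  assumes "finite A"
  shows "sum h (A - {x}) = (\<Sum>y\<in>A. if y = x then 0 else h y)"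
  using assms by (intro sum.mono_neutral_cong_left) auto

locale weighted_order =
  fixes lt :: "'a \<Rightarrow> 'a \<Rightarrow> bool" and f :: "nat \<Rightarrow> 'a \<Rightarrow> real" and r :: nat
  assumes irrefl: "\<not> lt x x"
    and trans: "lt x y \<Longrightarrow> lt y z \<Longrightarrow> lt x z"
    and weight_pos: "f j x > 0"
    and weight_ratio: "j < r \<Longrightarrow> lt x y \<Longrightarrow> f j y * f (Suc j) x \<le> f j x * f (Suc j) y"
begin

abbreviation "mins \<equiv> minimal_elements lt"
abbreviation "num \<equiv> weighted_count lt f"

text \<open>For \<open>x\<close> minimal in \<open>R\<close>, these letters become minimal only once
  \<open>x\<close> has been read.\<close>

definition fresh :: "'a set \<Rightarrow> 'a \<Rightarrow> 'a set" where
  "fresh R x = {y \<in> mins (R - {x}). lt x y}"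

definition collapse :: "'a \<Rightarrow> ('a + nat \<Rightarrow> real) \<Rightarrow> 'a + nat \<Rightarrow> real" where
  "collapse x v i =
     (case i of Inl y \<Rightarrow> if lt x y then v (Inl x) else v (Inl y) | Inr j \<Rightarrow> v (Inr j))"

text \<open>Vectors have a coordinate \<open>Inl x\<close> for each letter and a coordinate \<open>Inr j\<close> for each arc.
  At level \<open>k\<close>, inserting a vector into a count means either reading a first letter \<open>x\<close> in arc \<open>k\<close>,
  with factor \<open>v (Inl x)\<close>, or lengthening a later arc \<open>j\<close>, with factor \<open>v (Inr j)\<close>; the vector
  \<open>ones\<close> lengthens arc \<open>k\<close> itself. Geometrically, \<open>v (Inl x)\<close> is the displacement of the facet on
  which \<open>x\<close> attains its lower bound, and \<open>collapse x\<close> restricts displacements to that facet.\<close>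

definition lin :: "nat \<Rightarrow> 'a set \<Rightarrow> ('a + nat \<Rightarrow> real) \<Rightarrow> nat list \<Rightarrow> real" where
  "lin k R v js = (\<Sum>x\<in>mins R. f k x * v (Inl x) * num (R - {x}) js)
     + (\<Sum>j\<in>{k<..r}. v (Inr j) * num R (insort j js))"

text \<open>Two insertions, \<open>u\<close> before \<open>v\<close>, so the counts make sense for
  \<open>card R = length js + 2\<close>. The symmetry becomes visible in
  \<open>bil_expand\<close>.\<close>

definition bil :: "nat \<Rightarrow> 'a set \<Rightarrow> nat list \<Rightarrow> ('a + nat \<Rightarrow> real) \<Rightarrow> ('a + nat \<Rightarrow> real) \<Rightarrow> real" where
  "bil k R js u v = (\<Sum>x\<in>mins R. f k x * u (Inl x) * lin k (R - {x}) (collapse x v) js)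
     + (\<Sum>j\<in>{k<..r}. u (Inr j) * lin k R v (insort j js))"

definition ones :: "'a + nat \<Rightarrow> real" where
  "ones = case_sum (\<lambda>_. 1) (\<lambda>_. 0)"

lemma finite_mins [simp]: "finite R \<Longrightarrow> finite (mins R)"
  by (simp add: minimal_elements_def)

lemma mins_subset: "mins R \<subseteq> R"
  by (auto simp: minimal_elements_def)

lemma mins_not_lt: "x \<in> mins R \<Longrightarrow> y \<in> mins R \<Longrightarrow> \<not> lt x y"
  by (auto simp: minimal_elements_def)

lemma mins_nonempty:
  assumes "finite R" "R \<noteq> {}"
  shows "mins R \<noteq> {}"
proof -
  have "asymp lt" using irrefl trans by (metis asympI)
  moreover have "transp lt" using trans by (metis transpI)
  ultimately obtain m where "m \<in> R" "\<forall>y\<in>R. \<not> lt y m"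
    using Finite_Set.bex_min_element[OF assms(1) _ _ assms(2), of lt]
    by (metis asymp_on_subset irrefl transp_on_subset subset_UNIV)
  then show ?thesis by (auto simp: minimal_elements_def)
qed

lemma num_nonneg: "0 \<le> num R js"
  by (induction js arbitrary: R) (auto intro!: sum_nonneg mult_nonneg_nonneg simp: less_imp_le[OF weight_pos])

lemma num_pos: "finite R \<Longrightarrow> card R = length js \<Longrightarrow> 0 < num R js"
proof (induction js arbitrary: R)
  case Nil
  then show ?case by simp
next
  case (Cons j js)
  then have "R \<noteq> {}" by auto
  have "0 < num (R - {x}) js" if "x \<in> mins R" for x
    using Cons.IH[of "R - {x}"] Cons.prems that mins_subset[of R] by (auto simp: card_Diff_singleton)
  then show ?case
    using Cons.prems(1) \<open>R \<noteq> {}\<close> mins_nonempty weight_pos by (auto intro!: sum_pos)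
qed

lemma sum_mins_remove:
  fixes h :: "'a \<Rightarrow> real"
  assumes "finite R" "x \<in> mins R"
  shows "sum h (mins (R - {x})) = sum h (mins R - {x}) + sum h (fresh R x)"
proof -
  have "mins (R - {x}) = (mins R - {x}) \<union> fresh R x"
    using assms(2) by (auto simp: minimal_elements_def fresh_def)
  moreover have "(mins R - {x}) \<inter> fresh R x = {}"
    using assms(2) by (auto simp: minimal_elements_def fresh_def)
  moreover have "finite (fresh R x)"
    using assms(1) by (simp add: fresh_def)
  ultimately show ?thesis
    using assms(1) by (simp add: sum.union_disjoint)
qed

lemma collapse_ones [simp]: "collapse x ones = ones"
  by (auto simp: collapse_def ones_def split: sum.splits)

lemma collapse_Inr [simp]: "collapse x v (Inr j) = v (Inr j)"
  by (simp add: collapse_def)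

lemma lin_ones: "lin k R ones js = num R (k # js)"
  by (simp add: lin_def ones_def)

text \<open>The two letters read first are either both minimal in \<open>R\<close>, in which case they may be
  exchanged, or the second one becomes minimal by removing the first and then inherits its
  coordinate; both contributions are symmetric in \<open>u\<close> and \<open>v\<close>.\<close>

lemma bil_expand:
  assumes R: "finite R"
  shows "bil k R js u v =
      (\<Sum>x\<in>mins R. \<Sum>y\<in>mins R. if y = x then 0
          else f k x * f k y * (u (Inl x) * v (Inl y)) * num (R - {x} - {y}) js)
    + (\<Sum>x\<in>mins R. \<Sum>y\<in>fresh R x. f k x * f k y * (u (Inl x) * v (Inl x)) * num (R - {x} - {y}) js)
    + (\<Sum>j\<in>{k<..r}. \<Sum>x\<in>mins R. f k x * (u (Inl x) * v (Inr j) + u (Inr j) * v (Inl x)) * num (R - {x}) (insort j js))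
    + (\<Sum>i\<in>{k<..r}. \<Sum>j\<in>{k<..r}. u (Inr i) * v (Inr j) * num R (insort i (insort j js)))"
proof -
  have 1: "(\<Sum>y\<in>mins (R - {x}). f k y * collapse x v (Inl y) * num (R - {x} - {y}) js)
     = (\<Sum>y\<in>mins R. if y = x then 0 else f k y * v (Inl y) * num (R - {x} - {y}) js)
      + (\<Sum>y\<in>fresh R x. f k y * v (Inl x) * num (R - {x} - {y}) js)" if x: "x \<in> mins R" for x
    unfolding sum_mins_remove[OF R x] sum_Diff_singleton_if[OF finite_mins[OF R]]
    by (intro arg_cong2[where f="(+)"] sum.cong)
      (use x mins_not_lt in \<open>auto simp: collapse_def fresh_def\<close>)
  have 2: "(\<Sum>x\<in>mins R. f k x * u (Inl x) * lin k (R - {x}) (collapse x v) js)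
     = (\<Sum>x\<in>mins R. \<Sum>y\<in>mins R. if y = x then 0
          else f k x * f k y * (u (Inl x) * v (Inl y)) * num (R - {x} - {y}) js)
     + (\<Sum>x\<in>mins R. \<Sum>y\<in>fresh R x. f k x * f k y * (u (Inl x) * v (Inl x)) * num (R - {x} - {y}) js)
     + (\<Sum>x\<in>mins R. \<Sum>j\<in>{k<..r}. f k x * u (Inl x) * v (Inr j) * num (R - {x}) (insort j js))"
    unfolding sum.distrib[symmetric]
  proof (intro sum.cong refl)
    fix x assume x: "x \<in> mins R"
    show "f k x * u (Inl x) * lin k (R - {x}) (collapse x v) js =
      (\<Sum>y\<in>mins R. if y = x then 0
          else f k x * f k y * (u (Inl x) * v (Inl y)) * num (R - {x} - {y}) js)
     + (\<Sum>y\<in>fresh R x. f k x * f k y * (u (Inl x) * v (Inl x)) * num (R - {x} - {y}) js)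
     + (\<Sum>j\<in>{k<..r}. f k x * u (Inl x) * v (Inr j) * num (R - {x}) (insort j js))"
      unfolding lin_def 1[OF x]
      by (auto simp: distrib_left sum_distrib_left algebra_simps intro!: arg_cong2[where f="(+)"] sum.cong)
  qed
  have 3: "(\<Sum>j\<in>{k<..r}. u (Inr j) * lin k R v (insort j js))
     = (\<Sum>j\<in>{k<..r}. \<Sum>x\<in>mins R. f k x * u (Inr j) * v (Inl x) * num (R - {x}) (insort j js))
     + (\<Sum>i\<in>{k<..r}. \<Sum>j\<in>{k<..r}. u (Inr i) * v (Inr j) * num R (insort i (insort j js)))"
    unfolding lin_def sum.distrib[symmetric] distrib_left sum_distrib_left
    by (simp add: insort_left_comm algebra_simps)
  have 4: "(\<Sum>x\<in>mins R. \<Sum>j\<in>{k<..r}. f k x * u (Inl x) * v (Inr j) * num (R - {x}) (insort j js))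
    = (\<Sum>j\<in>{k<..r}. \<Sum>x\<in>mins R. f k x * u (Inl x) * v (Inr j) * num (R - {x}) (insort j js))"
    by (rule sum.swap)
  show ?thesis
    unfolding bil_def 2 3 4 by (simp add: distrib_left distrib_right sum.distrib mult.assoc)
qed

lemma bil_commute:
  assumes R: "finite R"
  shows "bil k R js u v = bil k R js v u"
proof -
  have 1: "(\<Sum>x\<in>mins R. \<Sum>y\<in>mins R. if y = x then 0
          else f k x * f k y * (u (Inl x) * v (Inl y)) * num (R - {x} - {y}) js)
    = (\<Sum>x\<in>mins R. \<Sum>y\<in>mins R. if y = x then 0
          else f k x * f k y * (v (Inl x) * u (Inl y)) * num (R - {x} - {y}) js)"
    by (subst sum.swap, intro sum.cong) (auto simp: Diff_insert2[symmetric] insert_commute mult_ac)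
  have 2: "(\<Sum>i\<in>{k<..r}. \<Sum>j\<in>{k<..r}. u (Inr i) * v (Inr j) * num R (insort i (insort j js)))
    = (\<Sum>i\<in>{k<..r}. \<Sum>j\<in>{k<..r}. v (Inr i) * u (Inr j) * num R (insort i (insort j js)))"
    by (subst sum.swap, intro sum.cong) (auto simp: insort_left_comm mult_ac)
  show ?thesis
    unfolding bil_expand[OF R] 1 2 by (simp add: mult_ac add_ac)
qed

lemma symmetric_bilinear_bil: "finite R \<Longrightarrow> symmetric_bilinear (bil k R js)"
  unfolding symmetric_bilinear_def
  by (intro conjI allI bil_commute) (simp_all add: bil_def algebra_simps sum.distrib sum_distrib_left)

text \<open>Inserting \<open>v\<close> and then \<open>ones\<close> is
  \<open>lin k R v (k # js)\<close> by definition; symmetry of \<open>bil\<close> exchanges the two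
  insertions.\<close>

lemma lin_Cons:
  assumes R: "finite R"
  shows "lin k R v (k # js) = bil k R js ones v"
proof -
  have "bil k R js v ones = lin k R v (k # js)"
    by (simp add: bil_def lin_ones lin_def[of k R v])
  then show ?thesis using bil_commute[OF R] by metis
qed

lemma bil_ones: "bil k R js ones v = (\<Sum>x\<in>mins R. f k x * lin k (R - {x}) (collapse x v) js)"
  by (simp add: bil_def ones_def)

text \<open>\<open>collapse x\<close> and \<open>collapse y\<close> do not commute on letters above both \<open>x\<close> and \<open>y\<close>. This is why
  \<open>bil_pull\<close> is only an inequality; the defect has a sign.\<close>

lemma lin_collapse_diff:
  assumes R: "finite R" and x: "x \<in> mins R" and y: "y \<in> mins R" and "x \<noteq> y"
  shows "0 \<le> (v (Inl y) - v (Inl x)) *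
    (lin k (R - {x} - {y}) (collapse y (collapse x v)) js - lin k (R - {x} - {y}) (collapse x (collapse y v)) js)"
proof -
  let ?S = "R - {x} - {y}"
  let ?d = "v (Inl y) - v (Inl x)"
  have "\<not> lt x y" "\<not> lt y x" using x y mins_not_lt by auto
  \<comment> \<open>A letter above both \<open>x\<close> and \<open>y\<close> takes the coordinate
    of the outer collapse; on other letters the two orders agree.\<close>
  then have "lin k ?S (collapse y (collapse x v)) js - lin k ?S (collapse x (collapse y v)) js
     = (\<Sum>z\<in>mins ?S. f k z * (if lt x z \<and> lt y z then ?d else 0) * num (?S - {z}) js)"
    unfolding lin_def
    by (auto simp: collapse_def sum_subtractf[symmetric] algebra_simps intro!: sum.cong)
  then have "?d * (lin k ?S (collapse y (collapse x v)) js - lin k ?S (collapse x (collapse y v)) js)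
     = (\<Sum>z\<in>mins ?S. f k z * (if lt x z \<and> lt y z then ?d\<^sup>2 else 0) * num (?S - {z}) js)"
    by (simp only: sum_distrib_left) (auto intro!: sum.cong simp: power2_eq_square)
  also have "\<dots> \<ge> 0"
    by (intro sum_nonneg mult_nonneg_nonneg num_nonneg) (auto simp: less_imp_le[OF weight_pos])
  finally show ?thesis .
qed

text \<open>Both sides consist of the terms \<open>?G x y\<close>, with coefficient
  \<open>v (Inl x)\<close> on the left and \<open>collapse x v (Inl y)\<close> on the right, plus
  equal sums over arcs. The coefficients agree for fresh \<open>y\<close>. For two minimal letters
  the differences at \<open>(x, y)\<close> and \<open>(y, x)\<close> combine to a positive multiple
  of the quantity in \<open>lin_collapse_diff\<close>.\<close>

lemma bil_pull:
  assumes R: "finite R"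
  shows "bil k R (k # js) v v \<le> (\<Sum>x\<in>mins R. f k x * bil k (R - {x}) js (collapse x v) (collapse x v))"
proof -
  let ?G = "\<lambda>x y. f k x * f k y * lin k (R - {x} - {y}) (collapse y (collapse x v)) js"
  have L: "bil k R (k # js) v v = (\<Sum>x\<in>mins R. v (Inl x) * (\<Sum>y\<in>mins (R - {x}). ?G x y))
     + (\<Sum>j\<in>{k<..r}. v (Inr j) * (\<Sum>x\<in>mins R. f k x * lin k (R - {x}) (collapse x v) (insort j js)))"
    using R by (simp add: bil_def[of k R "k # js"] lin_Cons bil_ones sum_distrib_left mult_ac)
  have Rt: "(\<Sum>x\<in>mins R. f k x * bil k (R - {x}) js (collapse x v) (collapse x v))
     = (\<Sum>x\<in>mins R. \<Sum>y\<in>mins (R - {x}). collapse x v (Inl y) * ?G x y)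
     + (\<Sum>j\<in>{k<..r}. v (Inr j) * (\<Sum>x\<in>mins R. f k x * lin k (R - {x}) (collapse x v) (insort j js)))"
  proof -
    have "(\<Sum>j\<in>{k<..r}. v (Inr j) * (\<Sum>x\<in>mins R. f k x * lin k (R - {x}) (collapse x v) (insort j js)))
      = (\<Sum>x\<in>mins R. f k x * (\<Sum>j\<in>{k<..r}. v (Inr j) * lin k (R - {x}) (collapse x v) (insort j js)))"
      unfolding sum_distrib_left by (subst sum.swap) (simp add: mult_ac)
    then show ?thesis
      by (simp add: bil_def distrib_left sum.distrib sum_distrib_left mult_ac)
  qed
  have fr: "(\<Sum>y\<in>mins (R - {x}). (collapse x v (Inl y) - v (Inl x)) * ?G x y)
     = (\<Sum>y\<in>mins R. if y = x then 0 else (v (Inl y) - v (Inl x)) * ?G x y)" if x: "x \<in> mins R" for x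
  proof -
    have "(\<Sum>y\<in>fresh R x. (collapse x v (Inl y) - v (Inl x)) * ?G x y) = 0"
      by (rule sum.neutral) (auto simp: fresh_def collapse_def)
    moreover have "(\<Sum>y\<in>mins R - {x}. (collapse x v (Inl y) - v (Inl x)) * ?G x y)
       = (\<Sum>y\<in>mins R - {x}. (v (Inl y) - v (Inl x)) * ?G x y)"
      by (rule sum.cong) (use x mins_not_lt in \<open>auto simp: collapse_def\<close>)
    ultimately show ?thesis
      unfolding sum_mins_remove[OF R x] using sum_Diff_singleton_if[OF finite_mins[OF R]] by simp
  qed
  define H where "H x y = (if y = x then 0 else (v (Inl y) - v (Inl x)) * ?G x y)" for x y
  have diff: "(\<Sum>x\<in>mins R. f k x * bil k (R - {x}) js (collapse x v) (collapse x v))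
     - bil k R (k # js) v v = (\<Sum>x\<in>mins R. \<Sum>y\<in>mins R. H x y)"
    unfolding L Rt H_def
    by (simp add: fr[symmetric] left_diff_distrib sum_subtractf sum_distrib_left cong: sum.cong)
  have "(\<Sum>x\<in>mins R. \<Sum>y\<in>mins R. H x y) = (\<Sum>x\<in>mins R. \<Sum>y\<in>mins R. H y x)"
    by (rule sum.swap)
  then have "2 * (\<Sum>x\<in>mins R. \<Sum>y\<in>mins R. H x y) = (\<Sum>x\<in>mins R. \<Sum>y\<in>mins R. H x y + H y x)"
    by (simp add: sum.distrib)
  also have "\<dots> \<ge> 0"
  proof (intro sum_nonneg)
    fix x y assume xy: "x \<in> mins R" "y \<in> mins R"
    show "0 \<le> H x y + H y x"
    proof (cases "x = y")
      case False
      have "R - {y} - {x} = R - {x} - {y}" by auto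
      then have "H x y + H y x = f k x * f k y * ((v (Inl y) - v (Inl x)) *
        (lin k (R - {x} - {y}) (collapse y (collapse x v)) js - lin k (R - {x} - {y}) (collapse x (collapse y v)) js))"
        using False by (simp add: H_def algebra_simps)
      then show ?thesis
        using lin_collapse_diff[OF R xy False] weight_pos by (simp add: less_imp_le)
    qed (simp add: H_def)
  qed
  finally show ?thesis using diff by linarith
qed

section \<open>Induction step: reading a first letter\<close>

definition unit :: "'a + nat \<Rightarrow> 'a + nat \<Rightarrow> real" where
  "unit i = (\<lambda>j. if j = i then 1 else 0)"

lemma bil_unit_Inl:
  assumes "finite R" "x \<in> mins R"
  shows "bil k R js (unit (Inl x)) v = f k x * lin k (R - {x}) (collapse x v) js"
proof -
  have "(\<Sum>y\<in>mins R. f k y * unit (Inl x) (Inl y) * lin k (R - {y}) (collapse y v) js)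
     = (\<Sum>y\<in>mins R. if y = x then f k x * lin k (R - {x}) (collapse x v) js else 0)"
    by (intro sum.cong) (auto simp: unit_def)
  then show ?thesis using assms by (simp add: bil_def) (simp add: unit_def)
qed

lemma bil_unit_Inr:
  assumes "j \<in> {k<..r}"
  shows "bil k R js (unit (Inr j)) v = lin k R v (insort j js)"
    and "lin k R (unit (Inr j)) js = num R (insort j js)"
proof -
  have "(\<Sum>i\<in>{k<..r}. unit (Inr j) (Inr i) * h i) = h j" for h :: "nat \<Rightarrow> real"
  proof -
    have "(\<Sum>i\<in>{k<..r}. unit (Inr j) (Inr i) * h i) = (\<Sum>i\<in>{k<..r}. if i = j then h j else 0)"
      by (intro sum.cong) (auto simp: unit_def)
    then show ?thesis using assms by simp
  qed
  then show "bil k R js (unit (Inr j)) v = lin k R v (insort j js)"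
    and "lin k R (unit (Inr j)) js = num R (insort j js)"
    by (simp_all add: bil_def lin_def) (simp_all add: unit_def)
qed

lemma bil_unit_unit:
  assumes R: "finite R" and x: "x \<in> mins R" and y: "y \<in> mins R" and "x \<noteq> y"
  shows "bil k R js (unit (Inl x)) (unit (Inl y)) = f k x * f k y * num (R - {x} - {y}) js"
proof -
  have *: "y \<in> mins (R - {x})"
    using assms by (auto simp: minimal_elements_def)
  have "collapse x (unit (Inl y)) = unit (Inl y)"
    using mins_not_lt[OF x y] \<open>x \<noteq> y\<close>
    by (auto simp: collapse_def unit_def split: sum.splits)
  moreover have "lin k (R - {x}) (unit (Inl y)) js = f k y * num (R - {x} - {y}) js"
  proof -
    have "(\<Sum>z\<in>mins (R - {x}). f k z * unit (Inl y) (Inl z) * num (R - {x} - {z}) js)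
       = (\<Sum>z\<in>mins (R - {x}). if z = y then f k y * num (R - {x} - {y}) js else 0)"
      by (intro sum.cong) (auto simp: unit_def)
    then show ?thesis using * R by (simp add: lin_def) (simp add: unit_def)
  qed
  ultimately show ?thesis
    by (simp add: bil_unit_Inl[OF R x])
qed

text \<open>Pairing with the unit vector of a minimal letter is, up to its weight, pairing with
  \<open>ones\<close> in the poset without that letter. The reversed inequality there bounds each
  summand of \<open>bil_pull\<close>, as \<open>hyperbolic_local_to_global\<close> requires.\<close>

lemma hyperbolic_bil_Cons:
  assumes R: "finite R" and card: "card R = Suc (length js) + 2"
    and IH: "\<And>x. x \<in> mins R \<Longrightarrow> hyperbolic (bil k (R - {x}) js)"
  shows "hyperbolic (bil k R (k # js))"
proof (rule hyperbolic_local_to_global[where E = "mins R" and g = "\<lambda>x. unit (Inl x)" and w = ones])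
  show "symmetric_bilinear (bil k R (k # js))"
    using R by (rule symmetric_bilinear_bil)
  show "finite (mins R)" using R by simp
  have "R \<noteq> {}" using card by auto
  then show "mins R \<noteq> {}" using R mins_nonempty by blast
  show "bil k R (k # js) ones v = (\<Sum>x\<in>mins R. bil k R (k # js) (unit (Inl x)) v)" for v
    using R by (simp add: bil_ones bil_unit_Inl)
  have card1: "card (R - {x}) = length js + 2" if "x \<in> mins R" for x
    using that mins_subset[of R] R card by (auto simp: card_Diff_singleton)
  show "0 < bil k R (k # js) (unit (Inl x)) (unit (Inl y))"
    if "x \<in> mins R" "y \<in> mins R" "x \<noteq> y" for x y
  proof -
    have "y \<in> R - {x}" using that mins_subset[of R] by auto
    then have "card (R - {x} - {y}) = length (k # js)"
      using card1[OF that(1)] R by (simp add: card_Diff_singleton)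
    then have "0 < num (R - {x} - {y}) (k # js)"
      using R by (intro num_pos) auto
    then show ?thesis
      unfolding bil_unit_unit[OF R that] using weight_pos by simp
  qed
  have pos: "0 < bil k (R - {x}) js ones ones" if "x \<in> mins R" for x
    using R card1[OF that] num_pos[of "R - {x}" "k # k # js"]
    by (simp flip: lin_Cons) (simp add: lin_ones)
  have unit_eq: "bil k R (k # js) (unit (Inl x)) v = f k x * bil k (R - {x}) js ones (collapse x v)"
    if "x \<in> mins R" for x v
    using R that by (simp add: bil_unit_Inl lin_Cons)
  show "0 < bil k R (k # js) (unit (Inl x)) ones" if "x \<in> mins R" for x
    using pos[OF that] weight_pos by (simp add: unit_eq[OF that])
  show "bil k R (k # js) v v \<le> (\<Sum>x\<in>mins R.
     (bil k R (k # js) (unit (Inl x)) v)\<^sup>2 / bil k R (k # js) (unit (Inl x)) ones)" for v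
  proof -
    have "f k x * bil k (R - {x}) js (collapse x v) (collapse x v)
      \<le> (bil k R (k # js) (unit (Inl x)) v)\<^sup>2 / bil k R (k # js) (unit (Inl x)) ones"
      if x: "x \<in> mins R" for x
    proof -
      let ?Q = "bil k (R - {x}) js" and ?v = "collapse x v"
      have "?Q ?v ?v \<le> (?Q ones ?v)\<^sup>2 / ?Q ones ones"
        using hyperbolicD[of ?Q ones ?v] symmetric_bilinear_bil[of "R - {x}" k js] R IH[OF x] pos[OF x] by simp
      then have "f k x * ?Q ?v ?v \<le> f k x * ((?Q ones ?v)\<^sup>2 / ?Q ones ones)"
        by (intro mult_left_mono) (auto simp: less_imp_le[OF weight_pos])
      also have "\<dots> = (f k x * ?Q ones ?v)\<^sup>2 / (f k x * ?Q ones ones)"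
        using weight_pos[of k x] by (simp add: power2_eq_square)
      finally show ?thesis by (simp add: unit_eq[OF x])
    qed
    then show ?thesis
      using bil_pull[OF R, of k js v] by (meson order_trans sum_mono)
  qed
qed

text \<open>Passage from level \<open>k\<close> to the next one, possible once no position of arc \<open>k\<close> is prescribed. It
  preserves \<open>lin\<close>, and it increases \<open>bil\<close> on the diagonal because the quotient of the weights
  is antitone.\<close>

definition lift :: "nat \<Rightarrow> ('a + nat \<Rightarrow> real) \<Rightarrow> 'a + nat \<Rightarrow> real" where
  "lift k v i = (case i of
      Inl x \<Rightarrow> v (Inr (Suc k)) + f k x / f (Suc k) x * v (Inl x)
    | Inr j \<Rightarrow> v (Inr j))"

lemma lift_simps [simp]:
  "lift k v (Inl x) = v (Inr (Suc k)) + f k x / f (Suc k) x * v (Inl x)"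
  "lift k v (Inr j) = v (Inr j)"
  by (simp_all add: lift_def)

lemma greaterThanAtMost_Suc: "k < r \<Longrightarrow> {k<..r} = insert (Suc k) {Suc k<..r}"
  by auto

text \<open>With no earlier arc prescribed, lengthening arc \<open>Suc k\<close> means reading a
  first letter in it. So the coordinate \<open>Inr (Suc k)\<close> is absorbed into the letter
  coordinates.\<close>

lemma lin_lift:
  assumes "k < r" "set js \<subseteq> {Suc k..}"
  shows "lin (Suc k) R (lift k v) js = lin k R v js"
proof -
  have "f (Suc k) x * (v (Inr (Suc k)) + f k x / f (Suc k) x * v (Inl x)) * c
    = v (Inr (Suc k)) * (f (Suc k) x * c) + f k x * v (Inl x) * c" for x c
    using weight_pos[of "Suc k" x] by (simp add: field_simps)
  moreover have "insort (Suc k) js = Suc k # js"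
    using assms(2) by (intro insort_is_Cons) auto
  ultimately show ?thesis
    unfolding lin_def greaterThanAtMost_Suc[OF assms(1)]
    by (simp add: sum.distrib sum_distrib_left)
qed

text \<open>\<open>lift k\<close> and \<open>collapse x\<close> do not commute on a letter
  \<open>y\<close> above \<open>x\<close>: one order uses the weight quotient of \<open>x\<close>,
  the other that of \<open>y\<close>. The added sum is this defect.\<close>

lemma bil_lift:
  assumes R: "finite R" and k: "k < r" and js: "set js \<subseteq> {Suc k..}"
  shows "bil (Suc k) R js (lift k u) (lift k v) = bil k R js u v
    + (\<Sum>x\<in>mins R. \<Sum>y\<in>fresh R x. f k x * f (Suc k) y *
        (f k x / f (Suc k) x - f k y / f (Suc k) y) * (u (Inl x) * v (Inl x)) * num (R - {x} - {y}) js)"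
proof -
  have c1: "lin (Suc k) (R - {x}) (collapse x (lift k v)) js = lin k (R - {x}) (collapse x v) js
     + (\<Sum>y\<in>fresh R x. f (Suc k) y * (f k x / f (Suc k) x - f k y / f (Suc k) y) * v (Inl x) * num (R - {x} - {y}) js)"
    if x: "x \<in> mins R" for x
  proof -
    have "lin (Suc k) (R - {x}) (collapse x (lift k v)) js - lin (Suc k) (R - {x}) (lift k (collapse x v)) js
      = (\<Sum>y\<in>mins (R - {x}). f (Suc k) y * (collapse x (lift k v) (Inl y) - lift k (collapse x v) (Inl y)) * num (R - {x} - {y}) js)"
      by (simp add: lin_def sum_subtractf[symmetric] algebra_simps)
    also have "\<dots> = (\<Sum>y\<in>fresh R x. f (Suc k) y * (f k x / f (Suc k) x - f k y / f (Suc k) y) * v (Inl x) * num (R - {x} - {y}) js)"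
    proof (rule sum.mono_neutral_cong_right)
      show "finite (mins (R - {x}))" using R by simp
    qed (auto simp: fresh_def collapse_def algebra_simps)
    finally show ?thesis
      using lin_lift[OF k js, of "R - {x}" "collapse x v"] by simp
  qed
  have js': "insort (Suc k) js = Suc k # js"
    using js by (intro insort_is_Cons) auto
  have c2: "lin k R v (insort j js) = lin (Suc k) R (lift k v) (insort j js)" if "j \<in> {k<..r}" for j
    using that js by (intro lin_lift[OF k, symmetric]) (auto simp: set_insort_key)
  have c3: "lin k R v (insort (Suc k) js) = (\<Sum>x\<in>mins R. f (Suc k) x * lin (Suc k) (R - {x}) (collapse x (lift k v)) js)"
    using c2[of "Suc k"] k by (simp add: js' lin_Cons[OF R] bil_ones)
  have "(\<Sum>x\<in>mins R. f (Suc k) x * lift k u (Inl x) * lin (Suc k) (R - {x}) (collapse x (lift k v)) js)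
    = u (Inr (Suc k)) * lin k R v (insort (Suc k) js)
     + (\<Sum>x\<in>mins R. f k x * u (Inl x) * lin (Suc k) (R - {x}) (collapse x (lift k v)) js)"
  proof -
    have "f (Suc k) x * (u (Inr (Suc k)) + f k x / f (Suc k) x * u (Inl x)) * c
      = u (Inr (Suc k)) * (f (Suc k) x * c) + f k x * u (Inl x) * c" for x c
      using weight_pos[of "Suc k" x] by (simp add: field_simps)
    then show ?thesis by (simp add: c3 sum.distrib sum_distrib_left)
  qed
  also have "(\<Sum>x\<in>mins R. f k x * u (Inl x) * lin (Suc k) (R - {x}) (collapse x (lift k v)) js)
    = (\<Sum>x\<in>mins R. f k x * u (Inl x) * lin k (R - {x}) (collapse x v) js)
     + (\<Sum>x\<in>mins R. \<Sum>y\<in>fresh R x. f k x * f (Suc k) y *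
        (f k x / f (Suc k) x - f k y / f (Suc k) y) * (u (Inl x) * v (Inl x)) * num (R - {x} - {y}) js)"
    by (simp add: c1 distrib_left sum.distrib sum_distrib_left mult_ac)
  finally show ?thesis
    unfolding bil_def greaterThanAtMost_Suc[OF k] using c2
    by (simp add: greaterThanAtMost_Suc[OF k])
qed

text \<open>The vector \<open>?w\<close> has no letter coordinates, so the defect in
  \<open>bil_lift\<close> vanishes against it and \<open>lift k\<close> preserves orthogonality to
  \<open>?w\<close>. On orthogonal vectors the lifted form is nonpositive, and it dominates the
  original on the diagonal.\<close>

lemma hyperbolic_bil_Suc:
  assumes R: "finite R" and k: "k < r" and js: "set js \<subseteq> {Suc k..}"
    and card: "card R = length js + 2"
    and hyp: "hyperbolic (bil (Suc k) R js)"
  shows "hyperbolic (bil k R js)"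
proof (rule hyperbolicI)
  let ?w = "unit (Inr (Suc k))"
  have w0: "?w (Inl x) = 0" for x by (simp add: unit_def)
  have lw: "bil (Suc k) R js (lift k ?w) (lift k v) = bil k R js ?w v" for v
    by (simp add: bil_lift[OF R k js] w0)
  show "symmetric_bilinear (bil k R js)" using R by (rule symmetric_bilinear_bil)
  show pos: "0 < bil k R js ?w ?w"
    using k R card by (simp add: bil_unit_Inr num_pos)
  fix v assume v: "bil k R js ?w v = 0"
  have "bil (Suc k) R js (lift k v) (lift k v) * bil (Suc k) R js (lift k ?w) (lift k ?w)
     \<le> (bil (Suc k) R js (lift k v) (lift k ?w))\<^sup>2"
    using hyp pos unfolding hyperbolic_def lw[symmetric] by blast
  also have "\<dots> = 0" using bil_commute[OF R, of "Suc k" js "lift k v"] by (simp add: lw v)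
  finally have "bil (Suc k) R js (lift k v) (lift k v) \<le> 0"
    using pos by (simp add: lw mult_le_0_iff)
  moreover have "bil k R js v v \<le> bil (Suc k) R js (lift k v) (lift k v)"
  proof -
    have "0 \<le> f k x / f (Suc k) x - f k y / f (Suc k) y" if "y \<in> fresh R x" for x y
      using that weight_ratio[OF k, of x y] weight_pos[of "Suc k" x] weight_pos[of "Suc k" y]
      by (simp add: fresh_def field_simps)
    then have "0 \<le> f k x * f (Suc k) y * (f k x / f (Suc k) x - f k y / f (Suc k) y) *
        (v (Inl x) * v (Inl x)) * num (R - {x} - {y}) js" if "y \<in> fresh R x" for x y
      using that by (intro mult_nonneg_nonneg[OF mult_nonneg_nonneg[OF mult_nonneg_nonneg]]
          num_nonneg zero_le_square) (simp add: less_imp_le[OF weight_pos])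
    then show ?thesis
      unfolding bil_lift[OF R k js] by (simp add: sum_nonneg)
  qed
  ultimately show "bil k R js v v \<le> 0" by linarith
qed

section \<open>Base case and induction for words\<close>

text \<open>The quadratic form is a multiple of a square for comparable letters and of a product of
  two coordinates otherwise.\<close>

lemma hyperbolic_bil_pair:
  assumes "card R = 2"
  shows "hyperbolic (bil r R [])"
proof -
  obtain p q where R: "R = {p, q}" and pq: "p \<noteq> q" and qp: "\<not> lt q p"
    using assms card_2_iff irrefl trans by (metis insert_commute)
  have sb: "symmetric_bilinear (bil r R [])"
    using R by (intro symmetric_bilinear_bil) simp
  have bil: "bil r R [] u v = (\<Sum>x\<in>mins R. f r x * u (Inl x) * (\<Sum>y\<in>mins (R - {x}). f r y * collapse x v (Inl y)))" for u v
    by (simp add: bil_def lin_def)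
  have single: "mins {x} = {x}" for x
    using irrefl by (auto simp: minimal_elements_def)
  have Rp: "R - {p} = {q}" and Rq: "R - {q} = {p}" using R pq by auto
  show ?thesis
  proof (cases "lt p q")
    case True
    then have "mins R = {p}" using R irrefl qp by (auto simp: minimal_elements_def)
    then have "bil r R [] u v = f r p * f r q * (u (Inl p) * v (Inl p))" for u v
      using True by (simp add: bil Rp single collapse_def)
    then show ?thesis
      by (intro hyperbolic_product[OF sb, where g = "\<lambda>v. f r p * f r q * v (Inl p)" and h = "\<lambda>v. v (Inl p)"])
        (simp_all add: mult_ac)
  next
    case False
    then have "mins R = {p, q}" using R irrefl qp by (auto simp: minimal_elements_def)
    then have "bil r R [] u v = f r p * f r q * (u (Inl p) * v (Inl q) + u (Inl q) * v (Inl p))" for u v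
      using False qp pq by (simp add: bil Rp Rq single collapse_def algebra_simps)
    then show ?thesis
      by (intro hyperbolic_product[OF sb, where g = "\<lambda>v. 2 * f r p * f r q * v (Inl p)" and h = "\<lambda>v. v (Inl q)"])
        (simp_all add: algebra_simps)
  qed
qed

text \<open>Either the list starts with \<open>k\<close> and a letter is read, or the level is
  raised; both decrease \<open>length js + (r - k)\<close>. At level \<open>r\<close> with an empty
  list, two letters remain.\<close>

theorem hyperbolic_bil:
  assumes "finite R" "card R = length js + 2" "sorted js" "set js \<subseteq> {k..r}" "k \<le> r"
  shows "hyperbolic (bil k R js)"
  using assms
proof (induction "length js + (r - k)" arbitrary: R js k rule: less_induct)
  case less
  show ?case
  proof (cases "\<exists>js'. js = k # js'")
    case True
    then obtain js' where js: "js = k # js'" by blast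
    show ?thesis
      unfolding js
    proof (rule hyperbolic_bil_Cons)
      show "hyperbolic (bil k (R - {x}) js')" if "x \<in> mins R" for x
        using that mins_subset[of R] less.prems unfolding js
        by (intro less.hyps) (auto simp: js card_Diff_singleton)
    qed (use less.prems js in auto)
  next
    case False
    then have js: "set js \<subseteq> {Suc k..r}"
      using less.prems(3,4) by (cases js) (force simp: Suc_le_eq)+
    show ?thesis
    proof (cases "k = r")
      case True
      then have "js = []" using js by (cases js) auto
      then show ?thesis using True less.prems hyperbolic_bil_pair by simp
    next
      case kr: False
      then have "k < r" using less.prems by simp
      show ?thesis
      proof (rule hyperbolic_bil_Suc)
        show "hyperbolic (bil (Suc k) R js)"
          using \<open>k < r\<close> less.prems js by (intro less.hyps) auto
      qed (use \<open>k < r\<close> less.prems js in auto)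
    qed
  qed
qed

end

section \<open>Gluing the outer arcs\<close>

definition inc :: "nat \<Rightarrow> (nat \<Rightarrow> nat) \<Rightarrow> nat \<Rightarrow> nat" where
  "inc x d = d(x := Suc (d x))"

text \<open>If \<open>W e\<close> is the coefficient of \<open>t^e / e!\<close> in a homogeneous
  polynomial of degree \<open>sum d {..3} + 2\<close>, this is the Hessian of its partial derivative
  of multi-order \<open>d\<close>.\<close>

definition hess :: "((nat \<Rightarrow> nat) \<Rightarrow> real) \<Rightarrow> (nat \<Rightarrow> nat) \<Rightarrow> (nat \<Rightarrow> real) \<Rightarrow> (nat \<Rightarrow> real) \<Rightarrow> real" where
  "hess W d u v = (\<Sum>x\<in>{..3}. \<Sum>y\<in>{..3}. u x * v y * W (inc x (inc y d)))"

text \<open>\<open>W\<close> is indexed by the lengths \<open>d 0, \<dots>, d 3\<close> of the four arcs. In \<open>circ W d\<close> the entry \<open>d 0\<close> is one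
  more than the joint length of arc \<open>0\<close> and of the part of arc \<open>3\<close> that is glued to it, whereas \<open>d 3\<close> is the
  length of the rest of arc \<open>3\<close>. The extra unit stands for the end of the word, which is a free point
  on the glued arc.\<close>

definition circ :: "((nat \<Rightarrow> nat) \<Rightarrow> real) \<Rightarrow> (nat \<Rightarrow> nat) \<Rightarrow> real" where
  "circ W d = (\<Sum>i<d 0. W (d(0 := i, 3 := d 0 - 1 - i + d 3)))"

definition basis :: "nat \<Rightarrow> nat \<Rightarrow> real" where
  "basis x y = (if y = x then 1 else 0)"

lemma inc_commute: "inc x (inc y d) = inc y (inc x d)"
  by (auto simp: inc_def fun_eq_iff)

lemma sum_inc: "x \<le> 3 \<Longrightarrow> sum (inc x d) {..3} = Suc (sum d {..(3::nat)})"
proof -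
  assume "x \<le> 3"
  then have "sum (inc x d) {..3} = Suc (d x) + sum (inc x d) ({..3} - {x})"
    by (subst sum.remove[of _ x]) (auto simp: inc_def)
  also have "sum (inc x d) ({..3} - {x}) = sum d ({..3} - {x})"
    by (rule sum.cong) (auto simp: inc_def)
  finally show ?thesis
    using \<open>x \<le> 3\<close> by (simp add: sum.remove[of "{..3}" x])
qed

text \<open>The last summand on the left puts the whole glued part into arc \<open>0\<close> and
  equals \<open>W d\<close>; in the others one unit moves over to \<open>d 3\<close>.\<close>

lemma circ_inc: "circ W (inc 0 d) = circ W (inc 3 d) + W d"
proof -
  have "(\<Sum>i<d 0. W (d(0 := i, 3 := d 0 - i + d 3))) = circ W (inc 3 d)"
    unfolding circ_def
  proof (intro sum.cong)
    fix i assume "i \<in> {..<inc 3 d 0}"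
    then have "i < d 0" by (simp add: inc_def)
    then show "W (d(0 := i, 3 := d 0 - i + d 3)) = W ((inc 3 d)(0 := i, 3 := inc 3 d 0 - 1 - i + inc 3 d 3))"
      by (intro arg_cong[where f = W]) (auto simp: inc_def fun_eq_iff)
  qed (simp add: inc_def)
  then show ?thesis
    by (simp add: circ_def inc_def)
qed

lemma circ_pos:
  assumes "\<And>d. sum d {..3} = n \<Longrightarrow> 0 < W d" "sum d {..3} = Suc n" "0 < d 0"
  shows "0 < circ W d"
  unfolding circ_def
proof (rule sum_pos)
  fix i assume "i \<in> {..<d 0}"
  then have "sum (d(0 := i, 3 := d 0 - 1 - i + d 3)) {..3} = n"
    using assms(2) by (simp add: eval_nat_numeral)
  then show "0 < W (d(0 := i, 3 := d 0 - 1 - i + d 3))" by (rule assms(1))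
qed (use assms(3) in auto)

lemma symmetric_bilinear_hess: "symmetric_bilinear (hess W d)"
  unfolding symmetric_bilinear_def
proof (intro conjI allI)
  fix u v show "hess W d u v = hess W d v u"
    unfolding hess_def
    by (subst sum.swap, intro sum.cong refl) (simp add: mult_ac inc_commute)
next
  fix u v w c show "hess W d (\<lambda>i. u i + c * v i) w = hess W d u w + c * hess W d v w"
    unfolding hess_def by (simp add: algebra_simps sum.distrib sum_distrib_left)
qed

lemma hess_basis:
  assumes "x \<le> 3"
  shows "hess W d (basis x) v = (\<Sum>y\<in>{..3}. v y * W (inc x (inc y d)))"
proof -
  have "hess W d (basis x) v = (\<Sum>z\<in>{..3}. if z = x then \<Sum>y\<in>{..3}. v y * W (inc x (inc y d)) else 0)"
    unfolding hess_def by (intro sum.cong) (auto simp: basis_def)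
  then show ?thesis using assms by simp
qed

lemma hess_basis_basis:
  assumes "x \<le> 3" "y \<le> 3"
  shows "hess W d (basis x) (basis y) = W (inc x (inc y d))"
proof -
  have "(\<Sum>z\<in>{..3}. basis y z * W (inc x (inc z d)))
      = (\<Sum>z\<in>{..3}. if z = y then W (inc x (inc y d)) else 0)"
    by (intro sum.cong) (auto simp: basis_def)
  then show ?thesis using assms by (simp add: hess_basis)
qed

lemma hess_circ_inc: "hess (circ W) (inc 0 d) u v = hess (circ W) (inc 3 d) u v + hess W d u v"
proof -
  have "circ W (inc x (inc y (inc 0 d))) = circ W (inc x (inc y (inc 3 d))) + W (inc x (inc y d))" for x y
    using circ_inc[of W "inc x (inc y d)"] by (metis inc_commute)
  then show ?thesis
    unfolding hess_def by (simp add: algebra_simps sum.distrib)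
qed

text \<open>Induction on \<open>d 0\<close>. For \<open>d 0 > 0\<close> the form is
  \<open>?Q + ?N\<close>, hyperbolic by induction and by assumption. Pairing it with
  \<open>basis 3\<close>, or with \<open>basis 0\<close> minus \<open>basis 3\<close>, is pairing
  \<open>?Q\<close>, respectively \<open>?N\<close>, with \<open>basis 0\<close>; so
  \<open>hyperbolic_local_to_global\<close> applies.\<close>

lemma hyperbolic_hess_circ:
  assumes pos: "\<And>d. sum d {..3} = n \<Longrightarrow> 0 < W d"
    and hyp: "\<And>d. sum d {..3} + 2 = n \<Longrightarrow> hyperbolic (hess W d)"
  shows "sum d {..3} + 1 = n \<Longrightarrow> hyperbolic (hess (circ W) d)"
proof (induction "d 0" arbitrary: d)
  case 0
  \<comment> \<open>Entries that leave \<open>d 0 = 0\<close> are empty sums, so the quadratic form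
    is divisible by \<open>v 0\<close>.\<close>
  have z: "circ W (inc x (inc y d)) = 0" if "x \<noteq> 0" "y \<noteq> 0" for x y
    using that 0 by (simp add: circ_def inc_def)
  let ?c = "\<lambda>y. circ W (inc 0 (inc y d))"
  have h: "hess (circ W) d u v = u 0 * v 0 * ?c 0 + (\<Sum>y\<in>{1,2,3}. (u 0 * v y + u y * v 0) * ?c y)" for u v
  proof -
    have "{..3} = {0, 1, 2, 3::nat}" by auto
    then show ?thesis
      unfolding hess_def by (simp add: z inc_commute[of "Suc 0" 0] inc_commute[of 2 0] inc_commute[of 3 0] algebra_simps)
  qed
  show ?case
    by (rule hyperbolic_product[OF symmetric_bilinear_hess, where g = "\<lambda>v. v 0"
          and h = "\<lambda>v. v 0 * ?c 0 + 2 * (\<Sum>y\<in>{1,2,3}. v y * ?c y)"])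
      (simp_all add: h algebra_simps)
next
  case (Suc m)
  define d' where "d' = d(0 := m)"
  have d: "d = inc 0 d'" using Suc.hyps(2) by (auto simp: d'_def inc_def)
  have size: "sum d' {..3} + 2 = n"
    using Suc.prems unfolding d by (simp add: sum_inc)
  let ?H = "hess (circ W) d" and ?Q = "hess (circ W) (inc 3 d')" and ?N = "hess W d'"
  \<comment> \<open>The unit taken from \<open>d 0\<close> goes to \<open>d 3\<close>, which keeps
    the total.\<close>
  have Q: "hyperbolic ?Q"
    using Suc.hyps(1)[of "inc 3 d'"] size by (simp add: sum_inc) (simp add: inc_def d'_def)
  have N: "hyperbolic ?N" using hyp size by blast
  have comm: "circ W (inc 3 (inc y (inc 0 d'))) = circ W (inc 0 (inc y (inc 3 d')))" for y
    by (metis inc_commute)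
  have gQ: "?H (basis 3) v = ?Q (basis 0) v" for v
    unfolding d by (simp add: hess_basis comm)
  have gN: "?H (basis 0) v - ?H (basis 3) v = ?N (basis 0) v" for v
  proof -
    have "circ W (inc 0 (inc y (inc 0 d'))) - circ W (inc 3 (inc y (inc 0 d'))) = W (inc 0 (inc y d'))" for y
      using circ_inc[of W "inc y (inc 0 d')"] by (simp add: inc_commute[of y 0])
    then show ?thesis
      unfolding d by (simp add: hess_basis sum_subtractf[symmetric] right_diff_distrib[symmetric])
  qed
  define g where "g b = (if b then basis 3 else (\<lambda>i. basis 0 i + (- 1) * basis 3 i))" for b :: bool
  note sym = symmetric_bilinear_hess[of "circ W" d]
  have gT: "?H (g True) v = ?Q (basis 0) v" for v
    by (simp add: g_def gQ)
  have gF: "?H (g False) v = ?N (basis 0) v" for v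
    using symmetric_bilinear_add_scaled(1)[OF sym, of "basis 0" "-1" "basis 3" v] gN[of v]
    by (simp add: g_def)
  have posN: "0 < ?N (basis 0) (basis x)" if "x \<le> 3" for x
    using that size by (simp add: hess_basis_basis pos sum_inc)
  have posQ: "0 < ?Q (basis 0) (basis 0)"
    using size by (simp add: hess_basis_basis) (intro circ_pos[OF pos], auto simp: sum_inc, simp add: inc_def)
  show ?case
  proof (rule hyperbolic_local_to_global[OF sym, where E = UNIV and g = g and w = "basis 0"])
    show "?H (basis 0) v = (\<Sum>b\<in>UNIV. ?H (g b) v)" for v
      using gN[of v] gQ[of v] by (simp add: UNIV_bool gT gF)
    have "0 < ?H (g False) (g True)"
      unfolding gF by (simp add: g_def posN)
    then show "0 < ?H (g b) (g b')" if "b \<noteq> b'" for b b'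
      using that symmetric_bilinear_commute[OF sym, of "g True" "g False"] by (cases b; cases b') auto
    show "0 < ?H (g b) (basis 0)" for b
      by (cases b) (simp_all add: gT gF posN posQ)
    show "?H v v \<le> (\<Sum>b\<in>UNIV. (?H (g b) v)\<^sup>2 / ?H (g b) (basis 0))" for v
    proof -
      have "?Q v v \<le> (?Q (basis 0) v)\<^sup>2 / ?Q (basis 0) (basis 0)"
        using hyperbolicD[of ?Q "basis 0" v] symmetric_bilinear_hess Q posQ by blast
      moreover have "?N v v \<le> (?N (basis 0) v)\<^sup>2 / ?N (basis 0) (basis 0)"
        using hyperbolicD[of ?N "basis 0" v] symmetric_bilinear_hess N posN[of 0] by blast
      moreover have "?H v v = ?Q v v + ?N v v"
        unfolding d by (rule hess_circ_inc)
      ultimately show ?thesis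
        by (simp add: UNIV_bool gT gF)
    qed
  qed auto
qed

text \<open>The inequality is tested on \<open>c\<close> and the combination \<open>u\<close> in
  which \<open>a\<close> and \<open>b\<close> contribute equally to \<open>Q u c\<close>. The terms
  with \<open>Q a a\<close> and \<open>Q b b\<close> are dropped; dividing by
  \<open>2 * s * t\<close> leaves the factor 2.\<close>

lemma hyperbolic_favard:
  assumes Q: "symmetric_bilinear Q" and hyp: "hyperbolic Q"
    and pos: "0 < Q c c" "0 < Q c a" "0 < Q c b" and nonneg: "0 \<le> Q a a" "0 \<le> Q b b"
  shows "Q c c * Q a b \<le> 2 * Q c a * Q c b"
proof -
  define s t where "s = Q c b" and "t = Q c a"
  define u where "u = (\<lambda>i. s * a i + t * b i)"
  have u: "u = (\<lambda>i. (0 + s * a i) + t * b i)" by (simp add: u_def)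
  have z: "Q (\<lambda>i. 0) v = 0" "Q v (\<lambda>i. 0) = 0" for v
    using symmetric_bilinear_add_scaled(1)[OF Q, of "\<lambda>i. 0" "-1" "\<lambda>i. 0" v]
      symmetric_bilinear_commute[OF Q, of v] by simp_all
  have "Q u u = s\<^sup>2 * Q a a + 2 * s * t * Q a b + t\<^sup>2 * Q b b"
    unfolding u symmetric_bilinear_add_scaled[OF Q] z
    by (simp add: symmetric_bilinear_commute[OF Q, of b a] algebra_simps power2_eq_square)
  then have "2 * s * t * Q a b * Q c c \<le> Q u u * Q c c"
    using pos nonneg by (intro mult_right_mono) auto
  also have "\<dots> \<le> (Q u c)\<^sup>2"
    using hyp pos(1) by (simp add: hyperbolic_def)
  also have "Q u c = 2 * s * t"
    unfolding u symmetric_bilinear_add_scaled[OF Q] z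
    by (simp add: symmetric_bilinear_commute[OF Q, of _ c] s_def t_def)
  finally have "(2 * s * t) * (Q c c * Q a b) \<le> (2 * s * t) * (2 * t * s)"
    by (simp add: power2_eq_square mult_ac)
  then show ?thesis
    using pos unfolding s_def t_def by (subst (asm) mult_le_cancel_left_pos) (simp_all add: mult_ac)
qed

lemma circ_cross_product:
  assumes pos: "\<And>d. sum d {..3} = n \<Longrightarrow> 0 < W d"
    and hyp: "\<And>d. sum d {..3} + 2 = n \<Longrightarrow> hyperbolic (hess W d)"
    and d: "sum d {..3} + 1 = n"
  shows "circ W (inc 0 (inc 0 d)) * circ W (inc 1 (inc 2 d))
    \<le> 2 * circ W (inc 0 (inc 1 d)) * circ W (inc 0 (inc 2 d))"
proof -
  have p: "0 < circ W (inc 0 (inc x d))" if "x \<le> 3" for x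
    using that d by (intro circ_pos[OF pos]) (auto simp: sum_inc, simp add: inc_def)
  \<comment> \<open>Only nonnegativity holds here: for \<open>d 0 = 0\<close> and
    \<open>x \<noteq> 0\<close> the sum is empty.\<close>
  have nn: "0 \<le> circ W (inc x (inc x d))" if "x \<le> 3" for x
  proof (cases "inc x (inc x d) 0 = 0")
    case False
    then show ?thesis
      using that d by (intro less_imp_le circ_pos[OF pos]) (auto simp: sum_inc)
  qed (simp add: circ_def)
  show ?thesis
    using hyperbolic_favard[OF symmetric_bilinear_hess hyperbolic_hess_circ[OF pos hyp d],
        of "basis 0" "basis 1" "basis 2"]
    by (simp add: hess_basis_basis p nn)
qed

section \<open>Arc lists and the inequality for weighted counts\<close>

definition arcs :: "(nat \<Rightarrow> nat) \<Rightarrow> nat list" where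
  "arcs d = replicate (d 0) 0 @ replicate (d 1) 1 @ replicate (d 2) 2 @ replicate (d 3) 3"

lemma sorted_arcs: "sorted (arcs d)"
  by (auto simp: arcs_def sorted_append)

lemma length_arcs: "length (arcs d) = sum d {..3}"
  by (simp add: arcs_def eval_nat_numeral)

lemma set_arcs: "set (arcs d) \<subseteq> {..3}"
  by (auto simp: arcs_def)

lemma insort_arcs:
  assumes "x \<le> 3"
  shows "insort x (arcs d) = arcs (inc x d)"
proof -
  have "x = 0 \<or> x = 1 \<or> x = 2 \<or> x = 3" using assms by auto
  then have "mset (arcs (inc x d)) = mset (insort x (arcs d))"
    by (auto simp: arcs_def inc_def)
  from properties_for_sort[OF this[symmetric]] properties_for_sort[OF refl, of "arcs (inc x d)"]
  show ?thesis by (simp add: sorted_arcs sorted_insort)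
qed

context weighted_order
begin

text \<open>\<open>emb\<close> gives every letter the coordinate of arc \<open>0\<close>, since
  reading a first letter with constant coordinate lengthens arc \<open>0\<close>. Such vectors are
  fixed by every \<open>collapse\<close>, and \<open>hess\<close> is the pullback of
  \<open>bil 0\<close> along \<open>emb\<close>.\<close>

lemma hyperbolic_hess_num:
  assumes r: "r = 3" and R: "finite R" and card: "sum d {..3} + 2 = card R"
  shows "hyperbolic (hess (\<lambda>d. num R (arcs d)) d)"
proof -
  define emb :: "(nat \<Rightarrow> real) \<Rightarrow> 'a + nat \<Rightarrow> real" where "emb v = case_sum (\<lambda>_. v 0) v" for v
  have col: "collapse x (emb v) = emb v" for x v
    by (auto simp: collapse_def emb_def split: sum.splits)
  have emb: "emb v (Inl x) = v 0" "emb v (Inr j) = v j" for v x j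
    by (simp_all add: emb_def)
  have all: "{..3} = insert 0 {0<..r}" using r by auto
  have ins0: "insort 0 js = 0 # js" for js :: "nat list"
    by (intro insort_is_Cons) auto
  have lin: "lin 0 S (emb v) js = (\<Sum>j\<in>{..3}. v j * num S (insort j js))" for S v js
    unfolding all by (simp add: lin_def emb ins0 sum_distrib_left mult_ac)
  have "bil 0 R js (emb u) (emb v) = (\<Sum>i\<in>{..3}. u i * lin 0 R (emb v) (insort i js))" for u v js
  proof -
    have "lin 0 R (emb v) (0 # js) = (\<Sum>x\<in>mins R. f 0 x * lin 0 (R - {x}) (emb v) js)"
      by (simp add: lin_Cons[OF R] bil_ones col)
    then show ?thesis
      unfolding all by (simp add: bil_def emb col ins0 sum_distrib_left mult_ac)
  qed
  then have eq: "hess (\<lambda>d. num R (arcs d)) d u v = bil 0 R (arcs d) (emb u) (emb v)" for u v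
    unfolding hess_def
    by (simp add: lin insort_arcs sum_distrib_left mult.assoc inc_commute)
  have "hyperbolic (bil 0 R (arcs d))"
    using R card r set_arcs[of d] by (intro hyperbolic_bil) (auto simp: length_arcs sorted_arcs)
  then show ?thesis
    unfolding hyperbolic_def eq by blast
qed

lemma num_cross_product:
  assumes r: "r = 3" and R: "finite R" and card: "sum d {..3} + 1 = card R"
  shows "circ (\<lambda>d. num R (arcs d)) (inc 0 (inc 0 d)) * circ (\<lambda>d. num R (arcs d)) (inc 1 (inc 2 d))
    \<le> 2 * circ (\<lambda>d. num R (arcs d)) (inc 0 (inc 1 d)) * circ (\<lambda>d. num R (arcs d)) (inc 0 (inc 2 d))"
  using R card
  by (intro circ_cross_product[where n = "card R"] num_pos hyperbolic_hess_num[OF r])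
    (auto simp: length_arcs)

end

section \<open>Linear extensions as words\<close>

definition words :: "('a \<Rightarrow> 'a \<Rightarrow> bool) \<Rightarrow> 'a set \<Rightarrow> 'a list set" where
  "words lt R = {w. distinct w \<and> set w = R \<and> sorted_wrt (\<lambda>x y. \<not> lt y x) w}"

lemma finite_words: "finite R \<Longrightarrow> finite (words lt R)"
proof -
  assume "finite R"
  moreover have "words lt R \<subseteq> {w. set w \<subseteq> R \<and> distinct w}"
    by (auto simp: words_def)
  ultimately show ?thesis
    using finite_subset finite_subset_distinct by blast
qed

lemma words_Cons:
  assumes "\<And>x. \<not> lt x x"
  shows "x # w \<in> words lt R \<longleftrightarrow> x \<in> minimal_elements lt R \<and> w \<in> words lt (R - {x})"
  using assms by (auto simp: words_def minimal_elements_def)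

lemma weighted_count_indicator:
  assumes irr: "\<And>x. \<not> lt x x"
    and "finite R" "card R = length js"
    and f: "\<And>j x. f j x = (if ok j x then 1 else 0)"
  shows "weighted_count lt f R js = card {w \<in> words lt R. list_all2 ok js w}"
  using assms(2,3)
proof (induction js arbitrary: R)
  case Nil
  then have "{w \<in> words lt R. list_all2 ok [] w} = {[]}"
    by (auto simp: words_def)
  then show ?case by simp
next
  case (Cons j js)
  let ?M = "{x \<in> minimal_elements lt R. ok j x}"
  let ?W = "\<lambda>x. {w \<in> words lt (R - {x}). list_all2 ok js w}"
  have fin: "finite (minimal_elements lt R)"
    using Cons.prems by (simp add: minimal_elements_def)
  have IH: "weighted_count lt f (R - {x}) js = card (?W x)" if "x \<in> minimal_elements lt R" for x
    using that Cons.prems by (intro Cons.IH) (auto simp: minimal_elements_def)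
  have "{w \<in> words lt R. list_all2 ok (j # js) w} = (\<Union>x\<in>?M. (#) x ` ?W x)"
    using words_Cons[of lt, OF irr] by (auto simp: list_all2_Cons1)
  also have "card \<dots> = (\<Sum>x\<in>?M. card ((#) x ` ?W x))"
    using fin finite_words[of "R - {_}" lt] Cons.prems by (intro card_UN_disjoint) auto
  also have "\<dots> = (\<Sum>x\<in>?M. card (?W x))"
    by (intro sum.cong refl card_image) (auto simp: inj_on_def)
  finally have card: "card {w \<in> words lt R. list_all2 ok (j # js) w} = (\<Sum>x\<in>?M. card (?W x))" .
  have "weighted_count lt f R (j # js) = (\<Sum>x\<in>minimal_elements lt R. if ok j x then real (card (?W x)) else 0)"
    by (auto simp: f IH intro!: sum.cong)
  also have "\<dots> = (\<Sum>x\<in>?M. real (card (?W x)))"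
    using fin by (simp add: sum.inter_filter)
  finally show ?case unfolding card by simp
qed

lemma tendsto_weighted_count:
  assumes "\<And>j x. ((\<lambda>e. f e j x) \<longlongrightarrow> g j x) G"
  shows "((\<lambda>e. weighted_count lt (f e) R js) \<longlongrightarrow> weighted_count lt g R js) G"
proof (induction js arbitrary: R)
  case (Cons j js)
  then show ?case
    by (simp add: tendsto_sum tendsto_mult assms)
qed simp

text \<open>The marked elements \<open>z 0, z 1, z 2\<close> split a word into four arcs, numbered
  \<open>0, \<dots>, 3\<close>, and \<open>z i\<close> precedes arc \<open>j\<close> iff \<open>i < j\<close>. The exponent below counts the relations
  with marked elements that are violated by a letter \<open>x\<close> of arc \<open>j\<close>.\<close>

definition violations :: "('a \<Rightarrow> 'a \<Rightarrow> bool) \<Rightarrow> (nat \<Rightarrow> 'a) \<Rightarrow> nat \<Rightarrow> 'a \<Rightarrow> nat" where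
  "violations lt z j x =
     (\<Sum>i<3. if i < j then of_bool (lt x (z i)) else of_bool (lt (z i) x))"

text \<open>Moving \<open>u\<close> from arc \<open>j\<close> to the next affects only its relation
  to \<open>z j\<close>: \<open>lt (z j) u\<close> ceases to be a violation and
  \<open>lt u (z j)\<close> becomes one. Passing from \<open>x\<close> to the larger
  \<open>y\<close> can only create the former relation and destroy the latter.\<close>

lemma violations_exchange:
  assumes trans: "\<And>x y w. lt x y \<Longrightarrow> lt y w \<Longrightarrow> lt x w" and "j < 3" and xy: "lt x y"
  shows "violations lt z j x + violations lt z (Suc j) y \<le> violations lt z j y + violations lt z (Suc j) x"
proof -
  have v: "violations lt z j u + of_bool (lt u (z j)) = violations lt z (Suc j) u + of_bool (lt (z j) u)" for u
  proof -
    have "violations lt z k u = (\<Sum>i\<in>{..<3} - {j}. if i < j then of_bool (lt u (z i)) else of_bool (lt (z i) u))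
       + (if k = j then of_bool (lt (z j) u) else of_bool (lt u (z j)))" if "k \<in> {j, Suc j}" for k
    proof -
      have "(\<Sum>i\<in>{..<3} - {j}. if i < k then of_bool (lt u (z i)) else of_bool (lt (z i) u) :: nat)
        = (\<Sum>i\<in>{..<3} - {j}. if i < j then of_bool (lt u (z i)) else of_bool (lt (z i) u))"
        using that by (intro sum.cong) auto
      then show ?thesis
        using that \<open>j < 3\<close> by (auto simp: violations_def sum.remove[of "{..<3}" j])
    qed
    from this[of j] this[of "Suc j"] show ?thesis by simp
  qed
  have "of_bool (lt (z j) x) \<le> (of_bool (lt (z j) y) :: nat)" "of_bool (lt y (z j)) \<le> (of_bool (lt x (z j)) :: nat)"
    using trans[OF _ xy] trans[OF xy] by auto
  then show ?thesis using v[of x] v[of y] by linarith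
qed

lemma weighted_order_violations:
  assumes "\<And>x. \<not> lt x x" "\<And>x y w. lt x y \<Longrightarrow> lt y w \<Longrightarrow> lt x w" "0 < e" "e \<le> (1::real)"
  shows "weighted_order lt (\<lambda>j x. e ^ violations lt z j x) 3"
proof
  fix j x y assume "j < (3::nat)" "lt x y"
  then show "e ^ violations lt z j y * e ^ violations lt z (Suc j) x
      \<le> e ^ violations lt z j x * e ^ violations lt z (Suc j) y"
    unfolding power_add[symmetric]
    using assms violations_exchange[of lt, OF assms(2)] by (intro power_decreasing) auto
qed (use assms in auto)

text \<open>The limit \<open>e = 0\<close> of the counts with weights \<open>e ^ violations\<close>.\<close>

definition num0 :: "('a \<Rightarrow> 'a \<Rightarrow> bool) \<Rightarrow> (nat \<Rightarrow> 'a) \<Rightarrow> 'a set \<Rightarrow> (nat \<Rightarrow> nat) \<Rightarrow> real" where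
  "num0 lt z R d = card {w \<in> words lt R. list_all2 (\<lambda>j x. violations lt z j x = 0) (arcs d) w}"

lemma num0_cross_product:
  assumes lt: "\<And>x. \<not> lt x x" "\<And>x y w. lt x y \<Longrightarrow> lt y w \<Longrightarrow> lt x w"
    and R: "finite R" and card: "sum d {..3} + 1 = card R"
  shows "circ (num0 lt z R) (inc 0 (inc 0 d)) * circ (num0 lt z R) (inc 1 (inc 2 d))
    \<le> 2 * circ (num0 lt z R) (inc 0 (inc 1 d)) * circ (num0 lt z R) (inc 0 (inc 2 d))"
proof -
  define f :: "real \<Rightarrow> nat \<Rightarrow> 'a \<Rightarrow> real" where "f e j x = e ^ violations lt z j x" for e j x
  define N where "N e d = weighted_count lt (f e) R (arcs d)" for e d
  \<comment> \<open>At \<open>e = 0\<close> the weight \<open>0 ^ n\<close> is the indicator of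
    \<open>n = 0\<close>.\<close>
  have N0: "N 0 d' = num0 lt z R d'" if "sum d' {..3} = card R" for d'
    unfolding N_def num0_def using that
    by (intro weighted_count_indicator lt(1) R) (auto simp: length_arcs f_def)
  have circ0: "circ (N 0) d' = circ (num0 lt z R) d'" if "sum d' {..3} = Suc (card R)" for d'
    unfolding circ_def
  proof (intro sum.cong refl N0)
    fix i assume "i \<in> {..<d' 0}"
    then show "sum (d'(0 := i, 3 := d' 0 - 1 - i + d' 3)) {..3} = card R"
      using that by (simp add: eval_nat_numeral)
  qed
  have lim: "((\<lambda>e. circ (N e) d') \<longlongrightarrow> circ (N 0) d') (at_right 0)" for d'
    unfolding circ_def N_def f_def
    by (intro tendsto_sum tendsto_weighted_count tendsto_power tendsto_ident_at)
  have ineq: "circ (N e) (inc 0 (inc 0 d)) * circ (N e) (inc 1 (inc 2 d))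
      \<le> 2 * circ (N e) (inc 0 (inc 1 d)) * circ (N e) (inc 0 (inc 2 d))" if "0 < e" "e \<le> 1" for e
  proof -
    interpret weighted_order lt "f e" 3
      unfolding f_def using lt that by (rule weighted_order_violations)
    show ?thesis
      unfolding N_def using R card by (intro num_cross_product) auto
  qed
  have "circ (N 0) (inc 0 (inc 0 d)) * circ (N 0) (inc 1 (inc 2 d))
      \<le> 2 * circ (N 0) (inc 0 (inc 1 d)) * circ (N 0) (inc 0 (inc 2 d))"
  proof (rule tendsto_le)
    show "((\<lambda>e. circ (N e) (inc 0 (inc 0 d)) * circ (N e) (inc 1 (inc 2 d))) \<longlongrightarrow>
        circ (N 0) (inc 0 (inc 0 d)) * circ (N 0) (inc 1 (inc 2 d))) (at_right 0)"
      by (intro tendsto_intros lim)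
    show "((\<lambda>e. 2 * circ (N e) (inc 0 (inc 1 d)) * circ (N e) (inc 0 (inc 2 d))) \<longlongrightarrow>
        2 * circ (N 0) (inc 0 (inc 1 d)) * circ (N 0) (inc 0 (inc 2 d))) (at_right 0)"
      by (intro tendsto_intros lim)
    show "\<forall>\<^sub>F e in at_right 0. circ (N e) (inc 0 (inc 0 d)) * circ (N e) (inc 1 (inc 2 d))
      \<le> 2 * circ (N e) (inc 0 (inc 1 d)) * circ (N e) (inc 0 (inc 2 d))"
      using ineq by (intro eventually_at_rightI[of 0 1]) auto
  qed simp
  then show ?thesis
    using card by (simp add: circ0 sum_inc)
qed

section \<open>Inserting the marked elements into words\<close>

lemma nth_decompose3:
  assumes "w ! i = x" "w ! Suc (i + a) = y" "w ! Suc (Suc (i + a + b)) = z" "Suc (Suc (i + a + b)) < length w"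
  shows "\<exists>u0 u1 u2 u3. w = u0 @ x # u1 @ y # u2 @ z # u3 \<and> length u0 = i \<and> length u1 = a \<and> length u2 = b"
proof -
  define w1 where "w1 = drop (Suc i) w"
  define w2 where "w2 = drop (Suc a) w1"
  have "w = take i w @ x # w1"
    using assms id_take_nth_drop[of i w] by (simp add: w1_def)
  moreover have "w1 = take a w1 @ y # w2"
    using assms id_take_nth_drop[of a w1] by (simp add: w1_def w2_def)
  moreover have "w2 = take b w2 @ z # drop (Suc b) w2"
    using assms id_take_nth_drop[of b w2] by (simp add: w1_def w2_def add_ac)
  ultimately have "w = take i w @ x # take a w1 @ y # take b w2 @ z # drop (Suc b) w2"
    by metis
  moreover have "length (take i w) = i" "length (take a w1) = a" "length (take b w2) = b"
    using assms by (auto simp: w1_def w2_def)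
  ultimately show ?thesis by blast
qed

lemma list_all2_replicate: "length u = n \<Longrightarrow> list_all2 P (replicate n j) u \<longleftrightarrow> (\<forall>x\<in>set u. P j x)"
  by (fastforce simp: list_all2_conv_all_nth in_set_conv_nth)

text \<open>The order conditions between letters and marked elements say that no letter has a
  violation in its arc; those among marked elements hold by assumption.\<close>

lemma words_insert_marked:
  assumes "length u0 = d 0" "length u1 = d 1" "length u2 = d 2" "length u3 = d 3"
    and z: "z 0 \<noteq> z 1" "z 0 \<noteq> z 2" "z 1 \<noteq> z (2::nat)" "{z 0, z 1, z 2} \<inter> R = {}"
    and lt: "\<not> lt (z 1) (z 0)" "\<not> lt (z 2) (z 0)" "\<not> lt (z 2) (z 1)"
  shows "u0 @ z 0 # u1 @ z 1 # u2 @ z 2 # u3 \<in> words lt (R \<union> {z 0, z 1, z 2}) \<longleftrightarrow>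
    u0 @ u1 @ u2 @ u3 \<in> words lt R \<and>
    list_all2 (\<lambda>j x. violations lt z j x = 0) (arcs d) (u0 @ u1 @ u2 @ u3)"
proof -
  have v: "(\<Sum>i<3. g i) = g 0 + g 1 + g 2" for g :: "nat \<Rightarrow> nat"
    by (simp add: eval_nat_numeral)
  have arcs: "list_all2 (\<lambda>j x. violations lt z j x = 0) (arcs d) (u0 @ u1 @ u2 @ u3) \<longleftrightarrow>
     (\<forall>x\<in>set u0. \<not> lt (z 0) x \<and> \<not> lt (z 1) x \<and> \<not> lt (z 2) x) \<and>
     (\<forall>x\<in>set u1. \<not> lt x (z 0) \<and> \<not> lt (z 1) x \<and> \<not> lt (z 2) x) \<and>
     (\<forall>x\<in>set u2. \<not> lt x (z 0) \<and> \<not> lt x (z 1) \<and> \<not> lt (z 2) x) \<and>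
     (\<forall>x\<in>set u3. \<not> lt x (z 0) \<and> \<not> lt x (z 1) \<and> \<not> lt x (z 2))"
    using assms(1-4) by (simp add: arcs_def list_all2_append list_all2_replicate violations_def v)
  have set: "set (u0 @ z 0 # u1 @ z 1 # u2 @ z 2 # u3) = set (u0 @ u1 @ u2 @ u3) \<union> {z 0, z 1, z 2}"
    by auto
  show ?thesis
  \<comment> \<open>If a marked element occurs among the letters, both sides are false: the left
    word repeats it, and the right one is not a word in \<open>R\<close>.\<close>
  proof (cases "{z 0, z 1, z 2} \<inter> set (u0 @ u1 @ u2 @ u3) = {}")
    case True
    then have "set (u0 @ z 0 # u1 @ z 1 # u2 @ z 2 # u3) = R \<union> {z 0, z 1, z 2} \<longleftrightarrow> set (u0 @ u1 @ u2 @ u3) = R"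
      unfolding set using z(4) by blast
    moreover have "distinct (u0 @ z 0 # u1 @ z 1 # u2 @ z 2 # u3) \<longleftrightarrow> distinct (u0 @ u1 @ u2 @ u3)"
      using True z by auto
    moreover have "sorted_wrt (\<lambda>x y. \<not> lt y x) (u0 @ z 0 # u1 @ z 1 # u2 @ z 2 # u3) \<longleftrightarrow>
      sorted_wrt (\<lambda>x y. \<not> lt y x) (u0 @ u1 @ u2 @ u3) \<and>
      list_all2 (\<lambda>j x. violations lt z j x = 0) (arcs d) (u0 @ u1 @ u2 @ u3)"
      unfolding arcs sorted_wrt_append sorted_wrt.simps set_append list.set using lt by blast
    ultimately show ?thesis unfolding words_def by blast
  next
    case False
    then have "\<not> distinct (u0 @ z 0 # u1 @ z 1 # u2 @ z 2 # u3)" by auto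
    moreover have "set (u0 @ u1 @ u2 @ u3) \<noteq> R" using False z(4) by blast
    ultimately show ?thesis unfolding words_def by blast
  qed
qed

text \<open>Both sets are injective images of the quadruples in \<open>U\<close>: \<open>J\<close>
  inserts the marked elements, \<open>K\<close> omits them. Each \<open>Suc\<close> in a position
  counts a marked element already passed.\<close>

lemma num0_eq_card_words:
  assumes "finite R" and d: "sum d {..3} = card R"
    and z: "z 0 \<noteq> z 1" "z 0 \<noteq> z 2" "z 1 \<noteq> z (2::nat)" "{z 0, z 1, z 2} \<inter> R = {}"
    and lt: "\<not> lt (z 1) (z 0)" "\<not> lt (z 2) (z 0)" "\<not> lt (z 2) (z 1)"
  shows "num0 lt z R d = card {w \<in> words lt (R \<union> {z 0, z 1, z 2}).
     w ! d 0 = z 0 \<and> w ! Suc (d 0 + d 1) = z 1 \<and> w ! Suc (Suc (d 0 + d 1 + d 2)) = z 2}"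
proof -
  let ?A = "{w \<in> words lt (R \<union> {z 0, z 1, z 2}).
     w ! d 0 = z 0 \<and> w ! Suc (d 0 + d 1) = z 1 \<and> w ! Suc (Suc (d 0 + d 1 + d 2)) = z 2}"
  let ?B = "{w \<in> words lt R. list_all2 (\<lambda>j x. violations lt z j x = 0) (arcs d) w}"
  define J where "J = (\<lambda>(u0, u1, u2, u3). u0 @ z 0 # u1 @ z 1 # u2 @ z 2 # u3)"
  define K where "K = (\<lambda>(u0, u1, u2, u3). u0 @ u1 @ u2 @ (u3 :: 'a list))"
  define U where "U = {(u0, u1, u2, u3). length u0 = d 0 \<and> length u1 = d 1 \<and> length u2 = d 2 \<and>
     length u3 = d 3 \<and> u0 @ z 0 # u1 @ z 1 # u2 @ z 2 # u3 \<in> words lt (R \<union> {z 0, z 1, z 2})}"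
  have d4: "d 0 + d 1 + d 2 + d 3 = card R"
    using d by (simp add: eval_nat_numeral)
  have "card (R \<union> {z 0, z 1, z 2}) = card R + 3"
    using z assms(1) by (subst card_Un_disjoint) auto
  then have len: "length w = card R + 3" if "w \<in> words lt (R \<union> {z 0, z 1, z 2})" for w
    using that distinct_card[of w] by (auto simp: words_def)
  have "J ` U = ?A"
  proof (intro equalityI subsetI)
    fix w assume w: "w \<in> ?A"
    then obtain u0 u1 u2 u3 where "w = u0 @ z 0 # u1 @ z 1 # u2 @ z 2 # u3"
        "length u0 = d 0" "length u1 = d 1" "length u2 = d 2"
      using nth_decompose3[of w "d 0" "z 0" "d 1" "z 1" "d 2" "z 2"] len[of w] d4 by auto
    moreover from this have "length u3 = d 3" using w len[of w] d4 by auto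
    ultimately show "w \<in> J ` U"
      using w by (intro image_eqI[of _ _ "(u0, u1, u2, u3)"]) (auto simp: J_def U_def)
  next
    fix w assume "w \<in> J ` U"
    then show "w \<in> ?A" by (auto simp: J_def U_def nth_append nth_Cons' )
  qed
  moreover have "inj_on J U"
    by (auto simp: inj_on_def J_def U_def)
  ultimately have A: "card ?A = card U" using card_image by metis
  have "K ` U = ?B"
  proof (intro equalityI subsetI)
    fix w assume w: "w \<in> ?B"
    then have "length w = d 0 + d 1 + d 2 + d 3"
      using list_all2_lengthD[of _ "arcs d" w] d d4 by (auto simp: length_arcs)
    moreover have "w = take (d 0) w @ take (d 1) (drop (d 0) w) @
        take (d 2) (drop (d 1) (drop (d 0) w)) @ drop (d 2) (drop (d 1) (drop (d 0) w))"
      by (simp del: drop_drop)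
    ultimately obtain u0 u1 u2 u3 where u: "w = u0 @ u1 @ u2 @ u3"
        "length u0 = d 0" "length u1 = d 1" "length u2 = d 2" "length u3 = d 3"
      using that[of "take (d 0) w" "take (d 1) (drop (d 0) w)" "take (d 2) (drop (d 1) (drop (d 0) w))"
          "drop (d 2) (drop (d 1) (drop (d 0) w))"] by simp
    then have "(u0, u1, u2, u3) \<in> U"
      using w words_insert_marked[of u0 d u1 u2 u3 z R lt] z lt by (simp add: U_def)
    then show "w \<in> K ` U" using u by (intro image_eqI[of _ _ "(u0, u1, u2, u3)"]) (auto simp: K_def)
  next
    fix w assume "w \<in> K ` U"
    then show "w \<in> ?B"
      using words_insert_marked[of _ d _ _ _ z R lt] z lt by (auto simp: K_def U_def)
  qed
  moreover have "inj_on K U"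
    by (auto simp: inj_on_def K_def U_def)
  ultimately have B: "card ?B = card U" using card_image by metis
  show ?thesis unfolding num0_def A B ..
qed

section \<open>From words back to linear extensions\<close>

text \<open>The word lists the elements by increasing value. Conversely \<open>L x\<close> is one
  plus the position of \<open>x\<close>, as values start at 1 and positions at 0.\<close>

lemma bij_betw_linear_extensions_words:
  fixes X :: "'a set"
  assumes "finite X" and lt: "\<And>x y. x \<in> X \<Longrightarrow> y \<in> X \<Longrightarrow> lt x y \<longleftrightarrow> prec x y" "\<And>x. \<not> lt x x"
  shows "bij_betw (\<lambda>L. map (inv_into X L) [1..<Suc (card X)]) (linear_extensions X prec) (words lt X)"
proof -
  let ?\<Psi> = "\<lambda>L. map (inv_into X L) [1..<Suc (card X)]"
  have bij: "bij_betw L X {1..card X}" "L \<in> X \<rightarrow>\<^sub>E {1..card X}" if "L \<in> linear_extensions X prec" for L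
    using that by (auto simp: linear_extensions_def)
  have inv: "inv_into X L m \<in> X" "L (inv_into X L m) = m"
    if "L \<in> linear_extensions X prec" "1 \<le> m" "m \<le> card X" for L m
    using bij(1)[OF that(1)] that(2,3)
    by (auto simp: bij_betw_def inv_into_into f_inv_into_f)
  show ?thesis
  proof (intro bij_betw_imageI inj_onI equalityI subsetI)
    fix L L' assume L: "L \<in> linear_extensions X prec" and L': "L' \<in> linear_extensions X prec"
      and eq: "?\<Psi> L = ?\<Psi> L'"
    have i: "inv_into X L m = inv_into X L' m" if "1 \<le> m" "m \<le> card X" for m
      using eq that by auto
    have "L x = L' x" if x: "x \<in> X" for x
    proof -
      have "L x \<in> {1..card X}" using bij(2)[OF L] x by auto
      moreover from this have "inv_into X L' (L x) = x"
        using i[of "L x"] bij(1)[OF L] x by (auto simp: bij_betw_def)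
      ultimately show ?thesis using inv(2)[OF L', of "L x"] by simp
    qed
    then show "L = L'"
      using bij(2)[OF L] bij(2)[OF L'] by (intro PiE_ext)
  next
    fix w assume "w \<in> ?\<Psi> ` linear_extensions X prec"
    then obtain L where L: "L \<in> linear_extensions X prec" and w: "w = ?\<Psi> L" by blast
    have "inj_on (inv_into X L) {1..<Suc (card X)}"
      by (rule inj_on_inverseI[of _ L]) (auto intro: inv(2)[OF L])
    then have "distinct w" by (simp add: w distinct_map del: upt_Suc)
    moreover have "set w = X"
      using bij(1)[OF L] bij_betw_inv_into[of L X "{1..card X}"]
      by (simp add: w bij_betw_def atLeastLessThanSuc_atLeastAtMost del: upt_Suc)
    moreover have "sorted_wrt (\<lambda>x y. \<not> lt y x) w"
      unfolding sorted_wrt_iff_nth_less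
    proof (intro allI impI notI)
      fix i j assume ij: "i < j" "j < length w" and l: "lt (w ! j) (w ! i)"
      then have "w ! i = inv_into X L (Suc i)" "w ! j = inv_into X L (Suc j)" "Suc j \<le> card X"
        by (auto simp: w simp del: upt_Suc)
      then have X: "w ! i \<in> X" "w ! j \<in> X" and Lw: "L (w ! i) = Suc i" "L (w ! j) = Suc j"
        using inv[OF L, of "Suc i"] inv[OF L, of "Suc j"] ij by auto
      have "prec (w ! j) (w ! i)" using l lt(1)[OF X(2,1)] by simp
      moreover have "\<forall>u\<in>X. \<forall>v\<in>X. prec u v \<longrightarrow> L u < L v"
        using L by (simp add: linear_extensions_def)
      ultimately have "L (w ! j) < L (w ! i)" using X by simp
      then show False using ij by (simp add: Lw)
    qed
    ultimately show "w \<in> words lt X" by (simp add: words_def)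
  next
    fix w assume w: "w \<in> words lt X"
    then have len: "length w = card X" using distinct_card[of w] by (auto simp: words_def)
    have b: "bij_betw ((!) w) {..<card X} X"
      using w len by (intro bij_betw_nth) (auto simp: words_def)
    define ix where "ix = inv_into {..<card X} ((!) w)"
    define L where "L = (\<lambda>x\<in>X. Suc (ix x))"
    have ix: "bij_betw ix X {..<card X}" unfolding ix_def by (rule bij_betw_inv_into[OF b])
    have w_ix: "w ! ix x = x" if "x \<in> X" for x
      using b that by (simp add: ix_def bij_betw_inv_into_right)
    have ix_w: "ix (w ! m) = m" if "m < card X" for m
      using b that by (simp add: ix_def bij_betw_inv_into_left)
    have bL: "bij_betw L X {1..card X}"
    proof -
      have "bij_betw Suc {..<card X} {1..card X}"
        by (auto simp: bij_betw_def image_Suc_lessThan)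
      from bij_betw_trans[OF ix this] have "bij_betw (Suc \<circ> ix) X {1..card X}" .
      then show ?thesis
        by (subst bij_betw_cong[of X L "Suc \<circ> ix"]) (auto simp: L_def)
    qed
    have "L u < L v" if uv: "u \<in> X" "v \<in> X" "prec u v" for u v
    proof (rule ccontr)
      assume "\<not> L u < L v"
      then have "ix v \<le> ix u" using uv by (simp add: L_def)
      moreover have "ix u \<noteq> ix v"
        using uv lt w_ix[of u] w_ix[of v] by (metis (no_types))
      moreover have "ix u < length w" using ix uv len by (auto simp: bij_betw_def)
      ultimately have "\<not> lt (w ! ix u) (w ! ix v)"
        using w by (auto simp: words_def sorted_wrt_iff_nth_less)
      then show False using uv lt w_ix by simp
    qed
    then have L: "L \<in> linear_extensions X prec"
      using bL bij_betwE[OF bL] unfolding linear_extensions_def by (simp add: L_def)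
    moreover have "?\<Psi> L = w"
    proof (rule nth_equalityI)
      fix m assume "m < length (?\<Psi> L)"
      then have m: "m < card X" by (simp del: upt_Suc)
      have "w ! m \<in> X" using m w len by (auto simp: words_def)
      then have "L (w ! m) = Suc m" using ix_w[OF m] by (simp add: L_def)
      then have "inv_into X L (Suc m) = w ! m"
        using bij_betw_inv_into_left[OF bL \<open>w ! m \<in> X\<close>] by simp
      then show "?\<Psi> L ! m = w ! m" using m by (simp del: upt_Suc)
    qed (simp add: len)
    ultimately show "w \<in> ?\<Psi> ` linear_extensions X prec" by (metis image_eqI)
  qed
qed

lemma card_linear_extensions_at:
  assumes "finite X" and lt: "\<And>x y. x \<in> X \<Longrightarrow> y \<in> X \<Longrightarrow> lt x y \<longleftrightarrow> prec x y" "\<And>x. \<not> lt x x"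
    and z: "z1 \<in> X" "z2 \<in> X" "z3 \<in> X" and p: "p1 < card X" "p2 < card X" "p3 < card X"
  shows "card {L \<in> linear_extensions X prec. L z1 = Suc p1 \<and> L z2 = Suc p2 \<and> L z3 = Suc p3}
    = card {w \<in> words lt X. w ! p1 = z1 \<and> w ! p2 = z2 \<and> w ! p3 = z3}"
proof -
  define \<Psi> where "\<Psi> L = map (inv_into X L) [1..<Suc (card X)]" for L :: "'a \<Rightarrow> nat"
  let ?S = "{L \<in> linear_extensions X prec. L z1 = Suc p1 \<and> L z2 = Suc p2 \<and> L z3 = Suc p3}"
  have b: "bij_betw \<Psi> (linear_extensions X prec) (words lt X)"
    unfolding \<Psi>_def by (rule bij_betw_linear_extensions_words[OF assms(1) lt])
  have pos: "\<Psi> L ! p = x \<longleftrightarrow> L x = Suc p"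
    if "L \<in> linear_extensions X prec" "x \<in> X" "p < card X" for L x p
  proof -
    have L: "bij_betw L X {1..card X}" using that by (simp add: linear_extensions_def)
    have "\<Psi> L ! p = inv_into X L (Suc p)" using that by (simp add: \<Psi>_def del: upt_Suc)
    then show ?thesis
      using bij_betw_inv_into_left[OF L that(2)] bij_betw_inv_into_right[OF L, of "Suc p"] that(3) by auto
  qed
  have "\<Psi> ` ?S = {w \<in> \<Psi> ` linear_extensions X prec. w ! p1 = z1 \<and> w ! p2 = z2 \<and> w ! p3 = z3}"
  proof (intro equalityI subsetI)
    fix w assume "w \<in> {w \<in> \<Psi> ` linear_extensions X prec. w ! p1 = z1 \<and> w ! p2 = z2 \<and> w ! p3 = z3}"
    then obtain L where L: "L \<in> linear_extensions X prec" and w: "w = \<Psi> L"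
      and nth: "\<Psi> L ! p1 = z1" "\<Psi> L ! p2 = z2" "\<Psi> L ! p3 = z3" by auto
    have "L \<in> ?S"
      using L nth pos[OF L z(1) p(1)] pos[OF L z(2) p(2)] pos[OF L z(3) p(3)] by simp
    then show "w \<in> \<Psi> ` ?S" unfolding w by (rule imageI)
  qed (use z p pos in auto)
  moreover have "inj_on \<Psi> ?S"
    using bij_betw_imp_inj_on[OF b] by (rule inj_on_subset) auto
  ultimately show ?thesis
    using card_image[of \<Psi> ?S] unfolding bij_betw_imp_surj_on[OF b] by simp
qed

text \<open>Here \<open>i\<close> is the number of letters before \<open>z 0\<close>, so
  \<open>L (z 0) = Suc i\<close>; \<open>d 1\<close> letters strictly between two marked elements
  make a difference of \<open>d 1 + 1\<close>. Since \<open>d 3 = 0\<close>, the last arc consists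
  of the remaining \<open>d 0 - 1 - i\<close> letters.\<close>

lemma F_eq_circ:
  fixes z :: "nat \<Rightarrow> 'a"
  assumes "finite R" and X: "X = R \<union> {z 0, z 1, z 2}"
    and z: "z 0 \<noteq> z 1" "z 0 \<noteq> z 2" "z 1 \<noteq> z 2" "{z 0, z 1, z 2} \<inter> R = {}"
    and lt: "\<And>x y. x \<in> X \<Longrightarrow> y \<in> X \<Longrightarrow> lt x y \<longleftrightarrow> prec x y" "\<And>x. \<not> lt x x"
      "\<not> lt (z 1) (z 0)" "\<not> lt (z 2) (z 0)" "\<not> lt (z 2) (z 1)"
    and d: "sum d {..3} = Suc (card R)" "d 3 = 0"
  shows "F X prec (z 0) (z 1) (z 2) (int (d 1) + 1) (int (d 2) + 1) = circ (num0 lt z R) d"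
proof -
  let ?S = "\<lambda>i. {L \<in> linear_extensions X prec. L (z 0) = Suc i \<and> L (z 1) = Suc (Suc (i + d 1)) \<and>
     L (z 2) = Suc (Suc (Suc (i + d 1 + d 2)))}"
  have finX: "finite X" and cardX: "card X = card R + 3"
    using z assms(1) by (auto simp: X card_Un_disjoint)
  have d3: "d 0 + d 1 + d 2 = Suc (card R)"
    using d by (simp add: eval_nat_numeral)
  have fin: "finite (linear_extensions X prec)"
    by (rule finite_subset[of _ "X \<rightarrow>\<^sub>E {1..card X}"])
      (auto simp: linear_extensions_def finX intro: finite_PiE)
  have "{L \<in> linear_extensions X prec. int (L (z 1)) - int (L (z 0)) = int (d 1) + 1 \<and>
      int (L (z 2)) - int (L (z 1)) = int (d 2) + 1} = (\<Union>i<d 0. ?S i)" (is "?A = ?B")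
  proof (intro equalityI subsetI)
    fix L assume "L \<in> ?A"
    then have L: "L \<in> linear_extensions X prec"
      and diff: "int (L (z 1)) - int (L (z 0)) = int (d 1) + 1" "int (L (z 2)) - int (L (z 1)) = int (d 2) + 1"
      by simp_all
    have "L \<in> X \<rightarrow>\<^sub>E {1..card X}" "z 0 \<in> X" "z 2 \<in> X"
      using L by (simp_all add: linear_extensions_def X)
    then have bounds: "1 \<le> L (z 0)" "L (z 2) \<le> card X" by (simp_all add: PiE_iff)
    then obtain i where i: "L (z 0) = Suc i" by (cases "L (z 0)") auto
    have L1: "L (z 1) = Suc (Suc (i + d 1))" using diff i by linarith
    then have L2: "L (z 2) = Suc (Suc (Suc (i + d 1 + d 2)))" using diff by linarith
    then have "i < d 0" using bounds d3 cardX by linarith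
    then show "L \<in> ?B" using L i L1 L2 by (intro UN_I[of i]) simp_all
  next
    fix L assume "L \<in> ?B"
    then show "L \<in> ?A" by fastforce
  qed
  then have "F X prec (z 0) (z 1) (z 2) (int (d 1) + 1) (int (d 2) + 1) = card (\<Union>i<d 0. ?S i)"
    by (simp only: F_def)
  also have "\<dots> = (\<Sum>i<d 0. card (?S i))"
    using fin by (intro card_UN_disjoint) auto
  finally have "F X prec (z 0) (z 1) (z 2) (int (d 1) + 1) (int (d 2) + 1) = (\<Sum>i<d 0. card (?S i))" .
  moreover have "card (?S i) = num0 lt z R (d(0 := i, 3 := d 0 - 1 - i + d 3))" if "i < d 0" for i
  proof -
    have words: "card (?S i) = card {w \<in> words lt X. w ! i = z 0 \<and> w ! Suc (i + d 1) = z 1 \<and>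
        w ! Suc (Suc (i + d 1 + d 2)) = z 2}"
      using that d3 cardX by (intro card_linear_extensions_at finX lt(1,2)) (auto simp: X)
    let ?d = "d(0 := i, 3 := d 0 - 1 - i + d 3)"
    have "sum ?d {..3} = card R"
      using that d by (simp add: eval_nat_numeral)
    from num0_eq_card_words[OF assms(1) this z lt(3-5)] show ?thesis
      unfolding words by (simp add: X)
  qed
  ultimately show ?thesis by (simp add: circ_def)
qed

lemma F_eq_0I:
  assumes "\<And>L. L \<in> linear_extensions X prec \<Longrightarrow>
    \<not> (int (L z2) - int (L z1) = a \<and> int (L z3) - int (L z2) = b)"
  shows "F X prec z1 z2 z3 a b = 0"
proof -
  have "{L \<in> linear_extensions X prec. int (L z2) - int (L z1) = a \<and> int (L z3) - int (L z2) = b} = {}"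
    using assms by auto
  then show ?thesis by (simp only: F_def card.empty)
qed

theorem theorem3p1:
  fixes X :: "'a set" and prec :: "'a \<Rightarrow> 'a \<Rightarrow> bool" and z1 z2 z3 :: 'a and k l :: int
  assumes "finite_poset X prec"
    and "z1 \<in> X" and "z2 \<in> X" and "z3 \<in> X"
    and "z1 \<noteq> z2" and "z1 \<noteq> z3" and "z2 \<noteq> z3"
    and "k \<ge> 1" and "l \<ge> 1"
  shows "F X prec z1 z2 z3 k l * F X prec z1 z2 z3 (k + 1) (l + 1)
           \<le> 2 * F X prec z1 z2 z3 (k + 1) l * F X prec z1 z2 z3 k (l + 1)"
proof -
  define R where "R = X - {z1, z2, z3}"
  \<comment> \<open>Cut down to \<open>X\<close>, the relation is irreflexive and transitive on the
    whole type.\<close>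
  define lt where "lt x y \<longleftrightarrow> x \<in> X \<and> y \<in> X \<and> prec x y" for x y
  define z where "z i = (if i = 0 then z1 else if i = 1 then z2 else z3)" for i :: nat
  obtain a b where k: "k = int a + 1" and l: "l = int b + 1"
    using assms(8,9) by (metis add.commute zle_iff_zadd)
  have finX: "finite X" and irr: "\<not> lt x x" and trans: "lt x y \<Longrightarrow> lt y w \<Longrightarrow> lt x w" for x y w
    using assms(1) by (auto simp: finite_poset_def lt_def irreflp_on_def transp_on_def)
  have X: "X = R \<union> {z 0, z 1, z 2}" and zR: "{z 0, z 1, z 2} \<inter> R = {}"
    using assms(2-4) by (auto simp: R_def z_def)
  have finR: "finite R" using finX by (simp add: R_def)
  have cardX: "card X = card R + 3"
    using card_Un_disjoint[OF finR _, of "{z1, z2, z3}"] X zR assms(5-7) by (simp add: z_def Int_commute)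
  show ?thesis
  \<comment> \<open>A reversed relation among marked elements contradicts
    \<open>k, l \<ge> 1\<close>, so the left side vanishes.\<close>
  proof (cases "lt z2 z1 \<or> lt z3 z1 \<or> lt z3 z2")
    case True
    have "F X prec z1 z2 z3 k l = 0"
    proof (intro F_eq_0I notI, elim conjE)
      fix L assume "L \<in> linear_extensions X prec"
      then have "L x < L y" if "lt x y" for x y
        using that by (auto simp: linear_extensions_def lt_def)
      moreover assume "int (L z2) - int (L z1) = k" "int (L z3) - int (L z2) = l"
      ultimately show False using True assms(8,9) by force
    qed
    then show ?thesis by simp
  next
    case lt: False
    show ?thesis
    \<comment> \<open>If this fails, differences \<open>k + 1\<close> and \<open>l + 1\<close> would
      span more than \<open>card X\<close> positions.\<close>
    proof (cases "a + b + 1 \<le> card R")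
      case False
      have "F X prec z1 z2 z3 (k + 1) (l + 1) = 0"
      proof (intro F_eq_0I notI, elim conjE)
        fix L assume "L \<in> linear_extensions X prec"
        then have "L z1 \<in> {1..card X}" "L z3 \<in> {1..card X}"
          using assms(2,4) by (auto simp: linear_extensions_def)
        moreover assume "int (L z2) - int (L z1) = k + 1" "int (L z3) - int (L z2) = l + 1"
        ultimately show False using False cardX k l by auto
      qed
      then show ?thesis by simp
    next
      case True
      \<comment> \<open>The case assumption makes the subtraction exact. The total is one less than
        \<open>card R\<close>; two further units give \<open>Suc (card R)\<close>, as
        \<open>circ\<close> needs.\<close>
      define d where "d x = (if x = 0 then card R - (a + b + 1) else if x = 1 then a else if x = 2 then b else 0)"
        for x :: nat
      have d: "sum d {..3} + 1 = card R"
        using True by (simp add: d_def eval_nat_numeral)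
      have F: "F X prec z1 z2 z3 (int (e 1) + 1) (int (e 2) + 1) = circ (num0 lt z R) e"
        if "sum e {..3} = Suc (card R)" "e 3 = 0" for e
      proof -
        have "z 0 \<noteq> z 1" "z 0 \<noteq> z 2" "z 1 \<noteq> z 2"
          "\<not> lt (z 1) (z 0)" "\<not> lt (z 2) (z 0)" "\<not> lt (z 2) (z 1)"
          using assms(5-7) lt by (simp_all add: z_def)
        moreover have "lt x y \<longleftrightarrow> prec x y" if "x \<in> X" "y \<in> X" for x y
          using that by (simp add: lt_def)
        ultimately have "F X prec (z 0) (z 1) (z 2) (int (e 1) + 1) (int (e 2) + 1) = circ (num0 lt z R) e"
          using finR X zR irr that by (intro F_eq_circ)
        then show ?thesis by (simp add: z_def)
      qed
      have s: "sum (inc x (inc y d)) {..3} = Suc (card R)" if "x \<le> 3" "y \<le> 3" for x y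
        using that d by (simp add: sum_inc)
      have d_simps: "d 1 = a" "d 2 = b" "d 3 = 0" by (simp_all add: d_def)
      have "real (F X prec z1 z2 z3 k l) = circ (num0 lt z R) (inc 0 (inc 0 d))"
        "real (F X prec z1 z2 z3 (k + 1) (l + 1)) = circ (num0 lt z R) (inc 1 (inc 2 d))"
        "real (F X prec z1 z2 z3 (k + 1) l) = circ (num0 lt z R) (inc 0 (inc 1 d))"
        "real (F X prec z1 z2 z3 k (l + 1)) = circ (num0 lt z R) (inc 0 (inc 2 d))"
        using F[of "inc 0 (inc 0 d)"] F[of "inc 1 (inc 2 d)"] F[of "inc 0 (inc 1 d)"] F[of "inc 0 (inc 2 d)"]
        by (simp_all add: s) (simp_all add: inc_def d_simps[simplified] k l add_ac)
      moreover have "circ (num0 lt z R) (inc 0 (inc 0 d)) * circ (num0 lt z R) (inc 1 (inc 2 d))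
        \<le> 2 * circ (num0 lt z R) (inc 0 (inc 1 d)) * circ (num0 lt z R) (inc 0 (inc 2 d))"
        using irr trans finR d by (rule num0_cross_product)
      ultimately have "real (F X prec z1 z2 z3 k l * F X prec z1 z2 z3 (k + 1) (l + 1))
         \<le> real (2 * F X prec z1 z2 z3 (k + 1) l * F X prec z1 z2 z3 k (l + 1))"
        by simp
      then show ?thesis by (simp only: of_nat_le_iff)
    qed
  qed
qed

end
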